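(* Let $s\in(0,1)$ and let $U_c$ be the contact potential of the pair of convex polyhedra $H_{ij},H_{i'j'}$. Then: (1) $U_c(d,\theta)=0$ whenever $\mathrm{dist}(H_{ij},H_{i'j'})\ge 2s/(1-s)$. (2) $\lim_{\mathrm{dist}(H_{ij},H_{i'j'})\to 0}U_c=\infty$. (3) $U_c$ is globally twice-differentiable in $d$ and $\theta$, i.e. it is twice differentiable at every $(d,\theta)$ with $U_c(d,\theta)<\infty$. (4) $U_c$ preserves linear and angular momentum: at every configuration with $U_c<\infty$, the contact forces $-\partial U_c/\partial y_m$ and $-\partial U_c/\partial z_m$ satisfy $$\sum_{m=1}^M\frac{\partial U_c}{\partial y_m}+\sum_{m=1}^M\frac{\partial U_c}{\partial z_m}=0,\qquad \sum_{m=1}^M y_m\times\frac{\partial U_c}{\partial y_m}+\sum_{m=1}^M z_m\times\frac{\partial U_c}{\partial z_m}=0.$$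
   Context: A robot has several rigid links; $d$ is a finite-dimensional real design vector collecting the local coordinates of all polyhedron vertices and of all joint attachment points, and $\theta$ is the finite-dimensional real configuration vector. Link $i$ (with parent $\lambda(i)$) has a rigid local-to-world transformation, the $4\times4$ homogeneous matrix $T_i(d,\theta)=T_{\lambda(i)}(d,\theta)\begin{pmatrix}R_i^d(d)&t_i^d(d)\\0&1\end{pmatrix}\begin{pmatrix}R_i(\theta)&t_i(\theta)\\0&1\end{pmatrix}$ with rotations $R_i^d,R_i$ and translations $t_i^d,t_i$, depending smoothly on $(d,\theta)$. Fix convex polyhedra $H_{ij}=\mathrm{conv}(x_{ij}^1,\dots,x_{ij}^M)$ on link $i$ and $H_{i'j'}=\mathrm{conv}(x_{i'j'}^1,\dots,x_{i'j'}^M)$ on link $i'\ne i$. Vertices are written in homogeneous coordinates, so $T_i(d,\theta)x_{ij}^m\in\mathbb{R}^4$ has last entry $1$; $[\cdot]_3$ extracts the first three entries. Write $y_m=[T_i(d,\theta)x_{ij}^m]_3$ and $z_m=[T_{i'}(d,\theta)x_{i'j'}^m]_3$ for the world-space vertices. $\mathrm{dist}(H_{ij},H_{i'j'})$ is the Euclidean distance between the world-space polyhedra $\mathrm{conv}\{y_m\}$ and $\mathrm{conv}\{z_m\}$. Barrier: $P_s(x)=(s-x)^4/x^5$ for $0<x<s$, $P_s(x)=0$ for $x\ge s$, and $P_s(x)=+\infty$ (undefined) for $x\le0$. For $p=(n,o)\in\mathbb{R}^3\times\mathbb{R}$ let $$U_{c\star}(d,\theta,p)=P_s(1-\|n\|)+\sum_{m=1}^M\left[P_s(-p^TT_i(d,\theta)x_{ij}^m)+P_s(p^TT_{i'}(d,\theta)x_{i'j'}^m)\right],$$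 and $U_c(d,\theta)=\min_pU_{c\star}(d,\theta,p)$ (value $+\infty$ if no $p$ gives a finite value). For the momentum statements, $U_c$ is regarded as a function of the world-space vertices $y_m,z_m$, through which alone it depends on $(d,\theta)$. *)

theory Defs
  imports "HOL-Analysis.Analysis"
begin

section \<open>Smooth maps\<close>

primrec C_k :: "nat \<Rightarrow> ('a::real_normed_vector \<Rightarrow> 'b::real_normed_vector) \<Rightarrow> bool" where
  "C_k 0 f \<longleftrightarrow> continuous_on UNIV f"
| "C_k (Suc n) f \<longleftrightarrow> (\<forall>x. f differentiable (at x)) \<and> (\<forall>v. C_k n (\<lambda>x. frechet_derivative f (at x) v))"

text \<open>In finite dimension (the only case used below) this is the usual class of infinitely
  differentiable maps, because directional derivatives along all vectors include all partial derivatives.\<close>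

definition smooth_map :: "('a::real_normed_vector \<Rightarrow> 'b::real_normed_vector) \<Rightarrow> bool" where
  "smooth_map f \<longleftrightarrow> (\<forall>k. C_k k f)"

section \<open>Differentiability of extended-real functions where they are finite\<close>

text \<open>The map \<open>real_of_ereal\<close> sends infinity to 0, so finiteness on a whole neighbourhood is
  demanded explicitly in both definitions.\<close>

definition ereal_twice_differentiable_at :: "('a::real_normed_vector \<Rightarrow> ereal) \<Rightarrow> 'a \<Rightarrow> bool" where
  "ereal_twice_differentiable_at f x \<longleftrightarrow>
     (\<forall>\<^sub>F u in nhds x. \<bar>f u\<bar> \<noteq> \<infinity>) \<and>
     (\<exists>D :: 'a \<Rightarrow> ('a \<Rightarrow>\<^sub>L real).
        (\<forall>\<^sub>F u in nhds x. ((\<lambda>v. real_of_ereal (f v)) has_derivative blinfun_apply (D u)) (at u)) \<and>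
        D differentiable (at x))"

definition ereal_has_gradient :: "('a::real_inner \<Rightarrow> ereal) \<Rightarrow> 'a \<Rightarrow> 'a \<Rightarrow> bool" where
  "ereal_has_gradient f x g \<longleftrightarrow>
     (\<forall>\<^sub>F u in nhds x. \<bar>f u\<bar> \<noteq> \<infinity>) \<and> GDERIV (\<lambda>v. real_of_ereal (f v)) x :> g"

section \<open>Homogeneous coordinates\<close>

definition hom4 :: "real^3 \<Rightarrow> real \<Rightarrow> real^4" where
  "hom4 v c = vector [v$1, v$2, v$3, c]"

definition first3 :: "real^4 \<Rightarrow> real^3" where
  "first3 w = vector [w$1, w$2, w$3]"

definition rigid4 :: "real^3^3 \<Rightarrow> real^3 \<Rightarrow> real^4^4" where
  "rigid4 R t = vector [hom4 (R$1) (t$1), hom4 (R$2) (t$2), hom4 (R$3) (t$3), hom4 0 1]"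

section \<open>The robot\<close>

text \<open>Here \<open>par i = None\<close> means that the parent frame of link \<open>i\<close> is the world frame. The design
  vector has type \<open>real^'nd\<close>, the configuration vector type \<open>real^'nq\<close>. The attachment points
  contained in the design vector enter only through \<open>Rd\<close> and \<open>td\<close>.\<close>

locale robot =
  fixes par :: "'l::finite \<Rightarrow> 'l option"
    and Rd :: "'l \<Rightarrow> real^'nd \<Rightarrow> real^3^3"
    and td :: "'l \<Rightarrow> real^'nd \<Rightarrow> real^3"
    and R :: "'l \<Rightarrow> real^'nq \<Rightarrow> real^3^3"
    and t :: "'l \<Rightarrow> real^'nq \<Rightarrow> real^3"
    and T :: "'l \<Rightarrow> real^'nd \<Rightarrow> real^'nq \<Rightarrow> real^4^4"
  assumes wf_par: "wf {(a, b). par b = Some a}"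
    and rotation_Rd: "rotation_matrix (Rd i d)"
    and rotation_R: "rotation_matrix (R i \<theta>)"
    and smooth_Rd: "smooth_map (Rd i)"
    and smooth_td: "smooth_map (td i)"
    and smooth_R: "smooth_map (R i)"
    and smooth_t: "smooth_map (t i)"
    and kinematics:
      "T i d \<theta> = (case par i of None \<Rightarrow> mat 1 | Some a \<Rightarrow> T a d \<theta>)
                   ** rigid4 (Rd i d) (td i d) ** rigid4 (R i \<theta>) (t i \<theta>)"

text \<open>Local vertex coordinates are entries of the design vector: \<open>vert i j m k\<close> is the position
  in \<open>d\<close> of coordinate \<open>k\<close> of vertex \<open>m\<close> of polyhedron \<open>j\<close> on link \<open>i\<close>.
  Vertices are indexed by a finite type \<open>'m\<close> with \<open>M = CARD('m)\<close>.\<close>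

definition local_vertex ::
  "('l \<Rightarrow> 'j \<Rightarrow> 'm \<Rightarrow> 3 \<Rightarrow> 'nd) \<Rightarrow> 'l \<Rightarrow> 'j \<Rightarrow> real^'nd \<Rightarrow> 'm \<Rightarrow> real^4" where
  "local_vertex vert i j d m = hom4 (\<chi> k. d $ vert i j m k) 1"

definition hom_world_vertex ::
  "('l \<Rightarrow> real^'nd \<Rightarrow> real^'nq \<Rightarrow> real^4^4) \<Rightarrow> ('l \<Rightarrow> 'j \<Rightarrow> 'm \<Rightarrow> 3 \<Rightarrow> 'nd) \<Rightarrow>
   'l \<Rightarrow> 'j \<Rightarrow> real^'nd \<Rightarrow> real^'nq \<Rightarrow> 'm \<Rightarrow> real^4" where
  "hom_world_vertex T vert i j d \<theta> m = T i d \<theta> *v local_vertex vert i j d m"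

definition world_vertex ::
  "('l \<Rightarrow> real^'nd \<Rightarrow> real^'nq \<Rightarrow> real^4^4) \<Rightarrow> ('l \<Rightarrow> 'j \<Rightarrow> 'm \<Rightarrow> 3 \<Rightarrow> 'nd) \<Rightarrow>
   'l \<Rightarrow> 'j \<Rightarrow> real^'nd \<Rightarrow> real^'nq \<Rightarrow> 'm \<Rightarrow> real^3" where
  "world_vertex T vert i j d \<theta> m = first3 (hom_world_vertex T vert i j d \<theta> m)"

definition world_polyhedron ::
  "('l \<Rightarrow> real^'nd \<Rightarrow> real^'nq \<Rightarrow> real^4^4) \<Rightarrow> ('l \<Rightarrow> 'j \<Rightarrow> 'm \<Rightarrow> 3 \<Rightarrow> 'nd) \<Rightarrow>
   'l \<Rightarrow> 'j \<Rightarrow> real^'nd \<Rightarrow> real^'nq \<Rightarrow> (real^3) set" where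
  "world_polyhedron T vert i j d \<theta> = convex hull (range (world_vertex T vert i j d \<theta>))"

section \<open>The contact potential\<close>

definition barrier :: "real \<Rightarrow> real \<Rightarrow> ereal" where
  "barrier s x = (if x \<le> 0 then \<infinity> else if x < s then ereal ((s - x)^4 / x^5) else 0)"

text \<open>The arguments \<open>Y\<close> and \<open>Z\<close> are the homogeneous world-space vertices.\<close>

definition plane_potential ::
  "real \<Rightarrow> ('m::finite \<Rightarrow> real^4) \<Rightarrow> ('m \<Rightarrow> real^4) \<Rightarrow> (real^3) \<times> real \<Rightarrow> ereal" where
  "plane_potential s Y Z = (\<lambda>(n, c). barrier s (1 - norm n) +
     (\<Sum>m\<in>UNIV. barrier s (- (hom4 n c \<bullet> Y m)) + barrier s (hom4 n c \<bullet> Z m)))"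

definition hom_contact_potential ::
  "real \<Rightarrow> ('m::finite \<Rightarrow> real^4) \<Rightarrow> ('m \<Rightarrow> real^4) \<Rightarrow> ereal" where
  "hom_contact_potential s Y Z = (INF p. plane_potential s Y Z p)"

definition contact_potential ::
  "real \<Rightarrow> ('l \<Rightarrow> real^'nd \<Rightarrow> real^'nq \<Rightarrow> real^4^4) \<Rightarrow> ('l \<Rightarrow> 'j \<Rightarrow> 'm::finite \<Rightarrow> 3 \<Rightarrow> 'nd) \<Rightarrow>
   'l \<Rightarrow> 'j \<Rightarrow> 'l \<Rightarrow> 'j \<Rightarrow> real^'nd \<Rightarrow> real^'nq \<Rightarrow> ereal" where
  "contact_potential s T vert i j i' j' d \<theta> =
     hom_contact_potential s (hom_world_vertex T vert i j d \<theta>) (hom_world_vertex T vert i' j' d \<theta>)"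

definition world_contact_potential ::
  "real \<Rightarrow> ('m::finite \<Rightarrow> real^3) \<Rightarrow> ('m \<Rightarrow> real^3) \<Rightarrow> ereal" where
  "world_contact_potential s y z = hom_contact_potential s (\<lambda>m. hom4 (y m) 1) (\<lambda>m. hom4 (z m) 1)"

section \<open>Consistency of the definitions\<close>

lemma hom4_nth [simp]: "hom4 v c $ 1 = v$1" "hom4 v c $ 2 = v$2" "hom4 v c $ 3 = v$3" "hom4 v c $ 4 = c"
  by (simp_all add: hom4_def vector_def)

lemma rigid4_row4: "rigid4 A b $ 4 = hom4 0 1"
  by (simp add: rigid4_def vector_def)

lemma hom4_first3: "w $ 4 = 1 \<Longrightarrow> hom4 (first3 w) 1 = w"
  by (simp add: vec_eq_iff forall_4 first3_def vector_3)

lemma inner_hom4: "hom4 n c \<bullet> hom4 v e = n \<bullet> v + c * e"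
  by (simp add: inner_vec_def sum_4 sum_3)

lemma row4_mult: "A $ 4 = hom4 0 1 \<Longrightarrow> B $ 4 = hom4 0 1 \<Longrightarrow> ((A::real^4^4) ** B) $ 4 = hom4 0 1"
  by (simp add: vec_eq_iff forall_4 matrix_matrix_mult_def sum_4)

lemma row4_one: "(mat 1 :: real^4^4) $ 4 = hom4 0 1"
  by (simp add: vec_eq_iff forall_4 mat_def)

lemma (in robot) T_row4: "T i d \<theta> $ 4 = hom4 0 1"
proof (induction i rule: wf_induct_rule[OF wf_par])
  case (1 i)
  have "(case par i of None \<Rightarrow> mat 1 | Some a \<Rightarrow> T a d \<theta>) $ 4 = hom4 0 1"
    using 1 by (auto simp: row4_one split: option.split)
  then show ?case
    by (subst kinematics) (intro row4_mult rigid4_row4)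
qed

lemma (in robot) contact_potential_world:
  "contact_potential s T vert i j i' j' d \<theta> =
     world_contact_potential s (world_vertex T vert i j d \<theta>) (world_vertex T vert i' j' d \<theta>)"
proof -
  have "hom_world_vertex T vert i j d \<theta> m $ 4 = 1" for i j m
    by (simp add: hom_world_vertex_def local_vertex_def matrix_vector_mult_def T_row4 sum_4)
  then show ?thesis
    by (simp add: contact_potential_def world_contact_potential_def world_vertex_def hom4_first3)
qed

text \<open>The infimum over \<open>p\<close> is always attained, so it is a minimum.\<close>

lemma barrier_nonneg: "0 \<le> barrier s x"
  by (simp add: barrier_def)

lemma continuous_barrier:
  assumes "0 < s" shows "isCont (barrier s) x"
proof -
  consider "x < 0" | "x = 0" | "x > 0" by linarith
  then show ?thesis
  proof cases
    case 1
    have "\<forall>\<^sub>F u in nhds x. barrier s u = (\<lambda>_. \<infinity>) u"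
      using eventually_nhds_in_open[of "{..<0}" x] 1 by (auto elim!: eventually_mono simp: barrier_def)
    then show ?thesis by (subst isCont_cong) auto
  next
    case 3
    have "\<forall>\<^sub>F u in nhds x. barrier s u = ereal ((max 0 (s - u))^4 / u^5)"
      using eventually_nhds_in_open[of "{0<..}" x] 3
      by (auto elim!: eventually_mono simp: barrier_def max_def)
    then show ?thesis
      using 3 by (subst isCont_cong) (auto intro!: continuous_intros)
  next
    case 2
    have "\<forall>\<^sub>F u in at 0. ereal B < barrier s u" for B
    proof -
      define e where "e = min (s/2) (min 1 ((s/2)^4 / (\<bar>B\<bar> + 1)))"
      have e: "e > 0" using assms by (simp add: e_def)
      have "ereal B < barrier s u" if "\<bar>u\<bar> < e" for u
      proof (cases "u \<le> 0")
        case True then show ?thesis by (simp add: barrier_def)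
      next
        case False
        then have u: "0 < u" "u < s/2" "u < 1" "u < (s/2)^4 / (\<bar>B\<bar> + 1)"
          using that by (auto simp: e_def)
        have "u * (\<bar>B\<bar> + 1) < (s/2)^4" using u(4) by (simp add: pos_less_divide_eq)
        moreover have "B * u \<le> u * (\<bar>B\<bar> + 1)" using u(1) mult_left_mono[of B "\<bar>B\<bar> + 1" u] by (simp add: mult.commute)
        ultimately have "B < (s/2)^4 / u" by (subst pos_less_divide_eq[OF u(1)]) (rule le_less_trans)
        also have "\<dots> \<le> (s - u)^4 / u"
          using u by (intro divide_right_mono power_mono) auto
        also have "\<dots> \<le> (s - u)^4 / u^5"
          using u power_decreasing[of 1 5 u] by (intro divide_left_mono) auto
        finally show ?thesis using u by (auto simp: barrier_def)
      qed
      then show ?thesis using e by (auto simp: eventually_at dist_real_def)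
    qed
    then have "(barrier s \<longlongrightarrow> \<infinity>) (at 0)" by (simp add: tendsto_PInfty)
    then show ?thesis by (simp add: 2 isCont_def barrier_def)
  qed
qed

lemma plane_potential_tendsto:
  assumes "0 < s"
  shows "(plane_potential s Y Z \<longlongrightarrow> plane_potential s Y Z p) (at p)"
proof -
  have b: "((\<lambda>u. barrier s (f u)) \<longlongrightarrow> barrier s (f p)) (at p)" if "isCont f p" for f :: "_ \<Rightarrow> real"
    using isCont_tendsto_compose[OF continuous_barrier[OF assms]] that by (auto simp: isCont_def)
  have ninf: "x \<noteq> - \<infinity>" if "0 \<le> x" for x :: ereal
    using that by auto
  have h: "isCont (\<lambda>u. hom4 (fst u) (snd u) \<bullet> w) p" for w :: "real^4" and p
    by (simp add: inner_vec_def sum_4)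
  have sum: "((\<lambda>u. \<Sum>m\<in>A. f m u) \<longlongrightarrow> (\<Sum>m\<in>A. f m p)) (at p)"
    if "\<And>m. (f m \<longlongrightarrow> f m p) (at p)" "\<And>m u. 0 \<le> (f m u::ereal)" for f A
  proof -
    have "f m p \<noteq> - \<infinity>" "sum (\<lambda>m. f m p) F \<noteq> - \<infinity>" for m F
      using that(2)[of m p] sum_nonneg[of F "\<lambda>m. f m p"] that(2) by auto
    then show ?thesis
      using that(1) by (induction A rule: infinite_finite_induct) (auto intro!: tendsto_add_ereal_general)
  qed
  have "((\<lambda>u. barrier s (1 - norm (fst u)) +
     (\<Sum>m\<in>UNIV. barrier s (- (hom4 (fst u) (snd u) \<bullet> Y m)) + barrier s (hom4 (fst u) (snd u) \<bullet> Z m)))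
     \<longlongrightarrow> barrier s (1 - norm (fst p)) +
     (\<Sum>m\<in>UNIV. barrier s (- (hom4 (fst p) (snd p) \<bullet> Y m)) + barrier s (hom4 (fst p) (snd p) \<bullet> Z m))) (at p)"
    by (intro tendsto_add_ereal_nonneg ninf sum b h continuous_intros sum_nonneg add_nonneg_nonneg barrier_nonneg)
  then show ?thesis by (simp add: plane_potential_def case_prod_beta')
qed

lemma world_contact_potential_attained:
  fixes y z :: "'m::finite \<Rightarrow> real^3"
  assumes "0 < s"
  shows "\<exists>p. world_contact_potential s y z =
    plane_potential s (\<lambda>m. hom4 (y m) 1) (\<lambda>m. hom4 (z m) 1) p"
proof -
  let ?f = "plane_potential s (\<lambda>m. hom4 (y m) 1) (\<lambda>m. hom4 (z m) 1)"
  obtain m0 :: 'm where True by simp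
  define B where "B = norm (y m0) + norm (z m0)"
  let ?K = "cball (0::real^3) 1 \<times> {- B..B}"
  have out: "?f p = \<infinity>" if "p \<notin> ?K" for p
  proof (rule ccontr)
    assume fin: "?f p \<noteq> \<infinity>"
    obtain n c where p: "p = (n, c)" by (cases p)
    have S: "(\<Sum>m\<in>UNIV. barrier s (- (n \<bullet> y m + c)) + barrier s (n \<bullet> z m + c)) \<noteq> \<infinity>"
      and n: "barrier s (1 - norm n) \<noteq> \<infinity>"
      using fin by (auto simp: p plane_potential_def inner_hom4)
    have "barrier s (- (n \<bullet> y m0 + c)) \<noteq> \<infinity>" "barrier s (n \<bullet> z m0 + c) \<noteq> \<infinity>"
      using S by (auto simp: sum_Pinfty)
    then have "n \<bullet> y m0 + c < 0" "n \<bullet> z m0 + c > 0" "norm n < 1"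
      using n by (auto simp: barrier_def split: if_splits)
    moreover have "\<bar>n \<bullet> y m0\<bar> \<le> norm (y m0)" "\<bar>n \<bullet> z m0\<bar> \<le> norm (z m0)"
      using Cauchy_Schwarz_ineq2[of n "y m0"] Cauchy_Schwarz_ineq2[of n "z m0"] \<open>norm n < 1\<close>
        mult_right_mono[of "norm n" 1 "norm (y m0)"] mult_right_mono[of "norm n" 1 "norm (z m0)"] by auto
    ultimately show False using that norm_ge_zero[of "y m0"] norm_ge_zero[of "z m0"]
      by (auto simp: p B_def)
  qed
  have "compact ?K" by (intro compact_Times) auto
  moreover have "?K \<noteq> {}" by (auto simp: B_def)
  moreover have "continuous_on ?K ?f"
    by (intro continuous_at_imp_continuous_on ballI)
       (simp add: isCont_def plane_potential_tendsto[OF assms])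
  ultimately obtain p where "p \<in> ?K" and p: "\<And>q. q \<in> ?K \<Longrightarrow> ?f p \<le> ?f q"
    by (meson continuous_attains_inf)
  have "?f p \<le> ?f q" for q using p[of q] out[of q] by (cases "q \<in> ?K") auto
  then have "(INF q. ?f q) = ?f p" by (intro antisym INF_lower INF_greatest) auto
  then show ?thesis unfolding world_contact_potential_def hom_contact_potential_def by (rule exI)
qed

end

theory Submission
  imports Defs
begin

text \<open>
  For fixed vertices the plane energy is convex in the plane. Where the minimum is positive, the norm
  term and at least one vertex term are active at any minimizer, which makes the Hessian in the plane
  positive definite; the implicit function theorem gives a differentiable branch of critical planes, which
  are global minimizers by convexity, and the envelope theorem identifies the gradient of the potential.
  Where the minimum is zero, the energy of the optimal plane grows at most quartically, and the bound
  \<open>P'\<^sup>2 \<le> C P\<close> makes the gradient quadratically small, so it is differentiable there too.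
  Momentum balance is stationarity of the energy in the offset and in the normal of the plane.
\<close>

subsection \<open>Differentiation tools\<close>

text \<open>The case split is forced. At energy zero all gaps are at least \<open>s\<close> and the
  norm of the normal is at most \<open>1 - s\<close>, so \<open>P'\<close> and \<open>P''\<close>
  vanish at every argument: the plane Hessian is zero, minimizing planes need not be unique, and no
  branch can be solved for. The gradient is therefore read off from an arbitrarily chosen minimizer,
  which is harmless because all minimizers compute the gradient of the same function. The bound on
  \<open>P'\<close> comes from the quartic numerator: with \<open>q = s - x\<close>, near
  \<open>s\<close> the square of \<open>P'\<close> is of order \<open>q^6\<close>, whereas
  \<open>P\<close> is of order \<open>q^4\<close>. The assumption \<open>s < 1\<close> enters
  through \<open>1 - s > 0\<close>: an active norm term keeps the normal away from 0, where the norm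
  has no derivative. The threshold \<open>2 * s / (1 - s)\<close> belongs to the plane halfway
  between two closest points at distance \<open>D\<close>, with a normal of length
  \<open>1 - s\<close>, the longest that costs nothing: its gaps are at least
  \<open>(1 - s) * D / 2\<close>, which has to reach \<open>s\<close>.\<close>

lemma has_derivative_zero_of_quadratic_bound:
  fixes f :: "'a::real_normed_vector \<Rightarrow> 'b::real_normed_vector"
  assumes "\<forall>\<^sub>F u in nhds x. norm (f u - f x) \<le> K * (norm (u - x))\<^sup>2"
  shows "(f has_derivative (\<lambda>_. 0)) (at x)"
proof -
  have ev: "\<forall>\<^sub>F u in at x. norm (norm (f u - f x) / norm (u - x)) \<le> \<bar>K\<bar> * norm (u - x)"
  proof -
    have "\<forall>\<^sub>F u in at x. norm (f u - f x) \<le> K * (norm (u - x))\<^sup>2"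
      using assms by (simp add: eventually_nhds_conv_at)
    then show ?thesis
    proof eventually_elim
      case (elim u)
      have "K * (norm (u - x))\<^sup>2 \<le> \<bar>K\<bar> * (norm (u - x))\<^sup>2"
        by (intro mult_right_mono) auto
      then show ?case
        using order_trans[OF elim] by (cases "u = x") (auto simp: divide_simps power2_eq_square mult.assoc)
    qed
  qed
  have "((\<lambda>u. \<bar>K\<bar> * norm (u - x)) \<longlongrightarrow> \<bar>K\<bar> * norm (x - x)) (at x)"
    by (intro tendsto_intros)
  then have "((\<lambda>u. norm (f u - f x) / norm (u - x)) \<longlongrightarrow> 0) (at x)"
    by (intro Lim_null_comparison[OF ev]) simp
  then show ?thesis
    unfolding has_derivative_iff_norm by (simp)
qed

text \<open>The inverse function theorem is applied to \<open>F (x, p) = (x, G (x, p))\<close>, and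
  the branch is the second component of the local inverse at \<open>(x, 0)\<close>. It is
  differentiable on all of \<open>U\<close>, not only at \<open>x0\<close>, because the local
  inverse is.\<close>

lemma implicit_function_differentiable:
  fixes G :: "'a::euclidean_space \<times> 'b::euclidean_space \<Rightarrow> 'b"
    and G' :: "'a \<times> 'b \<Rightarrow> 'a \<times> 'b \<Rightarrow> 'b"
  assumes S: "open S" "(x0, p0) \<in> S"
    and der: "\<And>z. z \<in> S \<Longrightarrow> (G has_derivative G' z) (at z)"
    and cont: "\<And>v. continuous_on S (\<lambda>z. G' z v)"
    and zero: "G (x0, p0) = 0"
    and inj: "\<And>q. G' (x0, p0) (0, q) = 0 \<Longrightarrow> q = 0"
  obtains U h where "open U" "x0 \<in> U"
    "\<And>x. x \<in> U \<Longrightarrow> (x, h x) \<in> S \<and> G (x, h x) = 0 \<and> h differentiable (at x)"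
proof -
  define F where "F z = (fst z, G z)" for z
  define F' where "F' z = Blinfun (\<lambda>v. (fst v, G' z v))" for z
  have bl: "bounded_linear (\<lambda>v. (fst v, G' z v))" if "z \<in> S" for z
    using der[OF that] by (intro bounded_linear_Pair bounded_linear_fst has_derivative_bounded_linear)
  have F'_apply: "blinfun_apply (F' z) v = (fst v, G' z v)" if "z \<in> S" for z v
    using bl[OF that] by (simp add: F'_def bounded_linear_Blinfun_apply)
  have derF: "(F has_derivative blinfun_apply (F' z)) (at z)" if "z \<in> S" for z
  proof -
    have "blinfun_apply (F' z) = (\<lambda>v. (fst v, G' z v))"
      using F'_apply[OF that] by auto
    then show ?thesis
      unfolding F_def[abs_def]
      by (auto intro!: has_derivative_Pair has_derivative_fst has_derivative_ident der that)
  qed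
  \<comment> \<open>In finite dimension, continuity in every fixed direction gives continuity in the
    operator norm.\<close>
  have contF': "continuous_on S F'"
  proof (rule continuous_on_blinfun_componentwise)
    fix v :: "'a \<times> 'b"
    have "continuous_on S (\<lambda>z. (fst v, G' z v))"
      by (intro continuous_intros cont)
    then show "continuous_on S (\<lambda>z. blinfun_apply (F' z) v)"
      by (rule continuous_on_eq) (simp add: F'_apply)
  qed
  let ?L = "blinfun_apply (F' (x0, p0))"
  have L: "linear ?L" by (simp add: linear_conv_bounded_linear blinfun.bounded_linear_right)
  have "inj ?L"
    unfolding linear_injective_0[OF L] using inj S(2) by (auto simp: F'_apply zero_prod_def)
  then obtain g where g: "linear g" "g \<circ> ?L = id"
    using linear_injective_left_inverse[OF L] by auto
  have "Blinfun g o\<^sub>L F' (x0, p0) = id_blinfun"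
    using fun_cong[OF g(2)] g(1)
    by (intro blinfun_eqI)
      (simp del: split_paired_All add: bounded_linear_Blinfun_apply linear_conv_bounded_linear)
  from inverse_function_theorem[OF S(1) derF contF' S(2) this]
  obtain U' V k k' where U': "open U'" "U' \<subseteq> S" "(x0, p0) \<in> U'" and V: "open V" "F (x0, p0) \<in> V"
    and hom: "homeomorphism U' V F k" and derk: "\<And>y. y \<in> V \<Longrightarrow> (k has_derivative k' y) (at y)"
    by metis
  define U where "U = (\<lambda>x. (x, 0::'b)) -` V"
  show thesis
  proof (rule that[of U "\<lambda>x. snd (k (x, 0))"])
    show "open U"
      unfolding U_def by (rule open_vimage[OF V(1)]) (intro continuous_intros)
    show "x0 \<in> U"
      using V(2) zero by (simp add: U_def F_def)
  next
    fix x assume "x \<in> U"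
    then have xV: "(x, 0) \<in> V" by (simp add: U_def)
    then have k: "k (x, 0) \<in> U'" "F (k (x, 0)) = (x, 0)"
      using hom by (auto simp: homeomorphism_def)
    then have "k (x, 0) = (x, snd (k (x, 0)))" "G (k (x, 0)) = 0"
      by (auto simp: F_def prod_eq_iff)
    moreover have "(\<lambda>x. k (x, 0)) differentiable (at x)"
      by (rule differentiable_compose[of k])
        (auto intro!: differentiableI[OF derk] xV derivative_intros)
    then have "(\<lambda>x. snd (k (x, 0))) differentiable (at x)"
      by (rule differentiable_compose[OF bounded_linear_imp_differentiable[OF bounded_linear_snd]])
    ultimately show "(x, snd (k (x, 0))) \<in> S \<and> G (x, snd (k (x, 0))) = 0
        \<and> (\<lambda>x. snd (k (x, 0))) differentiable (at x)"
      using k U'(2) by (metis subsetD)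
  qed
qed

subsection \<open>The scalar barrier\<close>

text \<open>Only the kink \<open>x = s\<close> needs an argument: an exponent of at least 2 makes
  the function quadratically small there, so its derivative is 0, which is also the value of the
  formula.\<close>

lemma DERIV_pos_part_power:
  "((\<lambda>x. (max 0 (s - x)) ^ (n + 2)) has_real_derivative - (real n + 2) * (max 0 (s - x)) ^ (n + 1)) (at x)"
proof -
  consider "x < s" | "x > s" | "x = s" by linarith
  then show ?thesis
  proof cases
    case 1
    have "((\<lambda>x. (s - x) ^ (n + 2)) has_real_derivative - (real n + 2) * (max 0 (s - x)) ^ (n + 1)) (at x)"
      by (rule DERIV_cong[OF DERIV_power[of "\<lambda>x. s - x" "-1"]])
        (use 1 in \<open>auto intro!: derivative_eq_intros simp: max_def algebra_simps\<close>)
    then show ?thesis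
      by (rule DERIV_cong_ev[THEN iffD1, rotated -1]) (use 1 in \<open>auto intro!: eventually_mono[OF eventually_nhds_in_open[of "{..<s}" x]]\<close>)
  next
    case 2
    have "((\<lambda>x. 0) has_real_derivative - (real n + 2) * (max 0 (s - x)) ^ (n + 1)) (at x)"
      using 2 by (auto simp: max_def)
    then show ?thesis
      by (rule DERIV_cong_ev[THEN iffD1, rotated -1]) (use 2 in \<open>auto intro!: eventually_mono[OF eventually_nhds_in_open[of "{s<..}" x]]\<close>)
  next
    case 3
    have "\<forall>\<^sub>F u in nhds x. norm ((max 0 (s - u)) ^ (n + 2) - (max 0 (s - x)) ^ (n + 2)) \<le> 1 * (norm (u - x))\<^sup>2"
    proof (rule eventually_mono[OF eventually_nhds_in_open[of "ball x 1" x]])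
      fix u assume "u \<in> ball x 1"
      then have "max 0 (s - u) ^ n \<le> 1" using 3
        by (intro power_le_one) (auto simp: dist_real_def)
      then have "max 0 (s - u) ^ n * (max 0 (s - u))\<^sup>2 \<le> 1 * (max 0 (s - u))\<^sup>2"
        by (intro mult_right_mono) auto
      also have "\<dots> \<le> (u - x)\<^sup>2" using 3 by (auto simp: max_def power2_commute)
      finally show "norm ((max 0 (s - u)) ^ (n + 2) - (max 0 (s - x)) ^ (n + 2)) \<le> 1 * (norm (u - x))\<^sup>2"
        using 3 by (simp add: power_add abs_mult del: power_Suc add_2_eq_Suc')
    qed auto
    from has_derivative_zero_of_quadratic_bound[OF this] show ?thesis
      using 3 by (simp add: has_field_derivative_def lambda_zero[symmetric])
  qed
qed

text \<open>Real-valued form of the barrier for \<open>x > 0\<close>; the positive part merges the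
  two branches at \<open>x = s\<close>. Values at \<open>x \<le> 0\<close> have no meaning and are
  kept out by feasibility.\<close>

definition pen :: "real \<Rightarrow> real \<Rightarrow> real" where
  "pen s x = (max 0 (s - x)) ^ 4 / x ^ 5"

text \<open>This derivative and the next are written as a power of the positive part times a factor
  that is positive for \<open>0 < x < s\<close>, so that signs and zeros can be read off.\<close>

definition pen' :: "real \<Rightarrow> real \<Rightarrow> real" where
  "pen' s x = - ((max 0 (s - x)) ^ 3 * (5 * s - x) / x ^ 6)"

definition pen'' :: "real \<Rightarrow> real \<Rightarrow> real" where
  "pen'' s x = (max 0 (s - x))\<^sup>2 * (3 * (5 * s - x) / x ^ 6 + max 0 (s - x) * (1 / x ^ 6 + 6 * (5 * s - x) / x ^ 7))"

text \<open>Where the positive part \<open>q\<close> is nonzero, \<open>x = s - q\<close>.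
  Multiplied by \<open>q\<close> this holds for all \<open>x\<close>, so the derivative can be
  simplified by pure algebra without cases.\<close>

lemma pos_part_mult: "max 0 (s - x) * x = max 0 (s - x) * s - (max 0 (s - x))\<^sup>2" for x s :: real
  by (simp add: max_def power2_eq_square algebra_simps)

lemma DERIV_pen:
  assumes "0 < x" shows "(pen s has_real_derivative pen' s x) (at x)"
proof -
  define q where "q = max 0 (s - x)"
  have "((\<lambda>x. (max 0 (s - x)) ^ (2 + 2) / x ^ 5) has_real_derivative
      (- (real 2 + 2) * q ^ (2 + 1) * x ^ 5 - q ^ (2 + 2) * (5 * x ^ 4)) / (x ^ 5 * x ^ 5)) (at x)"
    unfolding q_def using assms by (intro DERIV_divide DERIV_pos_part_power) (auto intro!: derivative_eq_intros)
  moreover have "(- (real 2 + 2) * q ^ (2 + 1) * x ^ 5 - q ^ (2 + 2) * (5 * x ^ 4)) / (x ^ 5 * x ^ 5)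
      = - (q ^ 3 * (5 * s - x) / x ^ 6)"
  proof -
    have "- 4 * q ^ 3 * x - 5 * q ^ 4 = - (q ^ 3 * (5 * s - x))"
      using pos_part_mult[of s x] unfolding q_def[symmetric] by algebra
    moreover have "(- (real 2 + 2) * q ^ (2 + 1) * x ^ 5 - q ^ (2 + 2) * (5 * x ^ 4)) / (x ^ 5 * x ^ 5)
      = (- 4 * q ^ 3 * x - 5 * q ^ 4) / x ^ 6"
      using assms by (simp add: field_simps) (simp add: algebra_simps eval_nat_numeral)
    ultimately show ?thesis by simp
  qed
  ultimately show ?thesis by (simp add: pen_def[abs_def] pen'_def q_def numeral_eq_Suc)
qed

lemma DERIV_pen':
  assumes "0 < x" shows "(pen' s has_real_derivative pen'' s x) (at x)"
proof -
  define q where "q = max 0 (s - x)"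
  have "((\<lambda>x. (max 0 (s - x)) ^ (1 + 2)) has_real_derivative - (real 1 + 2) * q ^ (1 + 1)) (at x)"
    unfolding q_def by (rule DERIV_pos_part_power)
  then have *: "((\<lambda>x. (max 0 (s - x)) ^ 3) has_real_derivative - 3 * q\<^sup>2) (at x)"
    by (simp add: numeral_eq_Suc)
  have "(pen' s has_real_derivative
     - (((- 3 * q\<^sup>2 * (5 * s - x) - q ^ 3) * x ^ 6 - q ^ 3 * (5 * s - x) * (6 * x ^ 5)) / (x ^ 6 * x ^ 6))) (at x)"
    unfolding pen'_def[abs_def]
    by (rule DERIV_cong[OF DERIV_minus[OF DERIV_divide[OF DERIV_mult[OF *, of "\<lambda>x. 5 * s - x" "-1"], of "\<lambda>x. x ^ 6" "6 * x ^ 5"]]])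
      (use assms in \<open>auto intro!: derivative_eq_intros simp: q_def algebra_simps\<close>)
  moreover have "- (((- 3 * q\<^sup>2 * (5 * s - x) - q ^ 3) * x ^ 6 - q ^ 3 * (5 * s - x) * (6 * x ^ 5)) / (x ^ 6 * x ^ 6))
    = pen'' s x"
    using assms unfolding pen''_def q_def[symmetric] by (simp add: field_simps) (simp add: algebra_simps eval_nat_numeral)
  ultimately show ?thesis by simp
qed

lemma continuous_on_pen'':
  assumes "continuous_on A f" "\<And>x. x \<in> A \<Longrightarrow> 0 < f x"
  shows "continuous_on A (\<lambda>x. pen'' s (f x))"
  unfolding pen''_def using assms
  by (intro continuous_intros) (auto simp: order_less_imp_not_eq2)

lemma pen_nonneg: "0 < x \<Longrightarrow> 0 \<le> pen s x"
  by (simp add: pen_def)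

lemma pen_eq_0_iff: "0 < x \<Longrightarrow> pen s x = 0 \<longleftrightarrow> s \<le> x"
  by (auto simp: pen_def max_def)

lemma pen'_nonpos: "0 < x \<Longrightarrow> pen' s x \<le> 0"
  by (cases "x < s") (auto simp: pen'_def max_def)

lemma pen'_eq_0_iff: "0 < x \<Longrightarrow> pen' s x = 0 \<longleftrightarrow> s \<le> x"
  by (auto simp: pen'_def max_def)

lemma pen''_nonneg: "0 < x \<Longrightarrow> 0 \<le> pen'' s x"
  by (cases "x < s") (auto simp: pen''_def max_def intro!: mult_nonneg_nonneg add_nonneg_nonneg)

lemma pen''_pos: "0 < x \<Longrightarrow> x < s \<Longrightarrow> 0 < pen'' s x"
  by (auto simp: pen''_def max_def intro!: mult_pos_pos add_pos_pos)

lemma barrier_eq_pen: "barrier s x = (if x \<le> 0 then \<infinity> else ereal (pen s x))"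
  by (auto simp: barrier_def pen_def max_def)

text \<open>Convexity on the positive axis, from the sign of the second derivative.\<close>

lemma pen_above_tangent:
  assumes "0 < a" "0 < b" shows "pen s a + pen' s a * (b - a) \<le> pen s b"
proof -
  have "pen' s a * (b - a) \<le> pen s b - pen s a"
    by (rule f''_imp_f'[where C = "{0<..}"])
      (use assms in \<open>auto intro: DERIV_pen DERIV_pen' pen''_nonneg simp: convex_real_interval\<close>)
  then show ?thesis by simp
qed

lemma pen_antimono:
  assumes "0 < a" "a \<le> b" shows "pen s b \<le> pen s a"
proof -
  have "0 \<le> pen' s b * (a - b)"
    using assms pen'_nonpos[of b s] by (intro mult_nonpos_nonpos) auto
  then show ?thesis using pen_above_tangent[of b a s] assms by linarith
qed

text \<open>The smallness condition is essential: as \<open>x\<close> tends to 0 the square of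
  \<open>pen'\<close> grows like \<open>x^(-12)\<close>, but \<open>pen\<close> only like
  \<open>x^(-5)\<close>.\<close>

lemma abs_pen'_le_sqrt_pen:
  assumes s: "0 < s"
  shows "\<exists>\<delta>>0. \<exists>C\<ge>0. \<forall>x>0. pen s x < \<delta> \<longrightarrow> \<bar>pen' s x\<bar> \<le> C * sqrt (pen s x)"
proof (intro exI conjI allI impI)
  \<comment> \<open>The quotient of the square of \<open>pen'\<close> by \<open>pen\<close> is
    \<open>q^2 * (5 * s - x)^2 / x^7\<close>; its numerator is at most
    \<open>s^2 * (5 * s)^2\<close>, and \<open>x > s / 2\<close> bounds the denominator.\<close>
  define C where "C = sqrt (25 * s ^ 4 / (s / 2) ^ 7)"
  \<comment> \<open>The value at \<open>s / 2\<close> serves as \<open>\<delta>\<close>: since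
    \<open>pen\<close> is decreasing, smaller values occur only for
    \<open>x > s / 2\<close>.\<close>
  show "0 < pen s (s/2)" using s by (simp add: pen_def)
  show "0 \<le> C" using s by (simp add: C_def)
  fix x assume x: "0 < x" and P: "pen s x < pen s (s/2)"
  have "x > s/2" using pen_antimono[of x "s/2" s] x P by fastforce
  show "\<bar>pen' s x\<bar> \<le> C * sqrt (pen s x)"
  proof (cases "x < s")
    case False then show ?thesis using pen'_eq_0_iff[OF x, of s] s \<open>0 \<le> C\<close> x by (simp add: pen_nonneg)
  next
    case True
    define q where "q = s - x"
    have "(pen' s x)\<^sup>2 = (q\<^sup>2 * (5 * s - x)\<^sup>2 / x ^ 7) * pen s x"
      using x True by (simp add: pen'_def pen_def max_def q_def[symmetric] field_simps eval_nat_numeral)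
    also have "\<dots> \<le> (25 * s ^ 4 / (s / 2) ^ 7) * pen s x"
    proof (intro mult_right_mono frac_le pen_nonneg)
      have "q\<^sup>2 * (5 * s - x)\<^sup>2 \<le> s\<^sup>2 * (5 * s)\<^sup>2"
        using x True by (intro mult_mono power_mono) (auto simp: q_def)
      then show "q\<^sup>2 * (5 * s - x)\<^sup>2 \<le> 25 * s ^ 4" by (simp add: eval_nat_numeral algebra_simps)
      show "(s / 2) ^ 7 \<le> x ^ 7" using s \<open>x > s/2\<close> by (intro power_mono) auto
    qed (use x s in auto)
    finally have "sqrt ((pen' s x)\<^sup>2) \<le> sqrt ((25 * s ^ 4 / (s / 2) ^ 7) * pen s x)"
      by (rule real_sqrt_le_mono)
    then show ?thesis unfolding C_def real_sqrt_mult by simp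
  qed
qed

subsection \<open>The energy of a separating plane\<close>

text \<open>Both vertex families are indexed jointly by \<open>'m + 'm\<close>; \<open>side\<close> makes every gap positive
  for a separating plane.\<close>

type_synonym plane = "(real^3) \<times> real"
type_synonym 'm vertices = "(real^3)^('m + 'm)"

definition side :: "'m + 'm \<Rightarrow> real" where
  "side = case_sum (\<lambda>_. - 1) (\<lambda>_. 1)"

definition gap :: "('m::finite) vertices \<Rightarrow> plane \<Rightarrow> 'm + 'm \<Rightarrow> real" where
  "gap w p k = side k * (fst p \<bullet> w $ k + snd p)"

definition feasible :: "('m::finite) vertices \<Rightarrow> plane \<Rightarrow> bool" where
  "feasible w p \<longleftrightarrow> norm (fst p) < 1 \<and> (\<forall>k. 0 < gap w p k)"

definition energy :: "real \<Rightarrow> ('m::finite) vertices \<Rightarrow> plane \<Rightarrow> real" where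
  "energy s w p = pen s (1 - norm (fst p)) + (\<Sum>k\<in>UNIV. pen s (gap w p k))"

definition vertex_grad :: "real \<Rightarrow> ('m::finite) vertices \<Rightarrow> plane \<Rightarrow> 'm vertices" where
  "vertex_grad s w p = (\<chi> k. (pen' s (gap w p k) * side k) *\<^sub>R fst p)"

text \<open>\<open>sgn\<close> is the gradient of the norm away from 0; its value 0 at 0 is a
  default, so the lemmas that read this as a derivative work with a nonzero normal.\<close>

definition plane_grad :: "real \<Rightarrow> ('m::finite) vertices \<Rightarrow> plane \<Rightarrow> plane" where
  "plane_grad s w p =
    ((\<Sum>k\<in>UNIV. (pen' s (gap w p k) * side k) *\<^sub>R w $ k) - pen' s (1 - norm (fst p)) *\<^sub>R sgn (fst p),
     \<Sum>k\<in>UNIV. pen' s (gap w p k) * side k)"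

definition minimal :: "real \<Rightarrow> ('m::finite) vertices \<Rightarrow> plane \<Rightarrow> bool" where
  "minimal s w p \<longleftrightarrow> feasible w p \<and> (\<forall>q. feasible w q \<longrightarrow> energy s w p \<le> energy s w q)"

lemma abs_side [simp]: "\<bar>side k\<bar> = 1"
  by (cases k) (auto simp: side_def)

lemma side_square [simp]: "side k * side k = 1"
  by (cases k) (auto simp: side_def)

lemma feasibleD:
  assumes "feasible w p" shows "0 < gap w p k" "norm (fst p) < 1"
  using assms by (auto simp: feasible_def)

lemma open_feasible: "open {z :: ('m::finite) vertices \<times> plane. feasible (fst z) (snd z)}"
proof -
  have "{z :: ('m::finite) vertices \<times> plane. feasible (fst z) (snd z)}
    = {z. norm (fst (snd z)) < 1} \<inter> (\<Inter>k. {z. 0 < gap (fst z) (snd z) k})"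
    by (auto simp: feasible_def)
  moreover have "open \<dots>"
    unfolding gap_def
    by (intro open_Int open_INT open_Collect_less ballI continuous_intros) auto
  ultimately show ?thesis by simp
qed

lemma open_feasible_nonzero:
  "open {z :: ('m::finite) vertices \<times> plane. feasible (fst z) (snd z) \<and> fst (snd z) \<noteq> 0}"
  by (intro open_Collect_conj open_feasible open_Collect_neq continuous_intros)

lemma energy_nonneg: "feasible w p \<Longrightarrow> 0 \<le> energy s w p"
  unfolding energy_def by (intro add_nonneg_nonneg sum_nonneg pen_nonneg) (auto simp: feasible_def)

lemma pen_gap_le_energy: "feasible w p \<Longrightarrow> pen s (gap w p k) \<le> energy s w p"
  unfolding energy_def
  by (rule add_increasing[OF _ member_le_sum]) (auto intro!: pen_nonneg simp: feasible_def)

lemma energy_eq_0D: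
  assumes "feasible w p" "energy s w p = 0"
  shows "s \<le> gap w p k" "norm (fst p) \<le> 1 - s"
proof -
  have "pen s (gap w p k) = 0"
    using pen_gap_le_energy[OF assms(1), of s k] assms pen_nonneg[OF feasibleD(1)[OF assms(1)], of s k] by simp
  then show "s \<le> gap w p k"
    using pen_eq_0_iff feasibleD(1)[OF assms(1)] by blast
  have "pen s (1 - norm (fst p)) \<le> 0" "0 \<le> pen s (1 - norm (fst p))"
    using assms sum_nonneg[of UNIV "\<lambda>k. pen s (gap w p k)"] pen_nonneg[OF feasibleD(1)[OF assms(1)]]
      pen_nonneg[of "1 - norm (fst p)" s] feasibleD(2)[OF assms(1)]
    by (auto simp: energy_def)
  then show "norm (fst p) \<le> 1 - s"
    using pen_eq_0_iff[of "1 - norm (fst p)" s] feasibleD(2)[OF assms(1)] by auto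
qed

section \<open>First derivative and convexity of the energy\<close>

lemma has_derivative_gap:
  "((\<lambda>z. gap (fst z) (snd z) k) has_derivative
     (\<lambda>h. side k * (fst (snd h) \<bullet> w $ k + fst p \<bullet> fst h $ k + snd (snd h)))) (at (w, p))"
  unfolding gap_def
  by (auto intro!: derivative_eq_intros bounded_linear.has_derivative[OF bounded_linear_vec_nth]
      simp: algebra_simps inner_commute)

lemma has_derivative_norm_normal:
  fixes p :: "plane"
  assumes "fst p \<noteq> 0"
  shows "((\<lambda>z. norm (fst (snd z))) has_derivative (\<lambda>h. fst (snd h) \<bullet> sgn (fst p))) (at (w, p))"
proof -
  have "(norm has_derivative (\<lambda>h. h \<bullet> sgn (fst p))) (at (fst (snd (w, p))))"
    using GDERIV_norm[OF assms] by (simp add: gderiv_def)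
  then show ?thesis
    by (rule has_derivative_compose[rotated]) (auto intro!: derivative_eq_intros)
qed

text \<open>The derivative is joint in vertices and plane because it is used three ways: with fixed
  vertices for stationarity, with a fixed plane for the envelope argument, and along a branch of
  planes.\<close>

lemma has_derivative_energy:
  fixes w :: "('m::finite) vertices"
  assumes "feasible w p" "fst p \<noteq> 0"
  shows "((\<lambda>z. energy s (fst z) (snd z)) has_derivative
     (\<lambda>h. vertex_grad s w p \<bullet> fst h + plane_grad s w p \<bullet> snd h)) (at (w, p))"
proof -
  have 1: "((\<lambda>z. 1 - norm (fst (snd z))) has_derivative (\<lambda>h. - (fst (snd h) \<bullet> sgn (fst p)))) (at (w, p))"
    by (rule derivative_eq_intros has_derivative_norm_normal assms refl)+ simp
  have 2: "((\<lambda>z. pen s (1 - norm (fst (snd z)))) has_derivative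
      (\<lambda>h. - (fst (snd h) \<bullet> sgn (fst p)) * pen' s (1 - norm (fst p)))) (at (w, p))"
    using DERIV_compose_FDERIV[OF _ 1, of "pen s" "pen' s (1 - norm (fst p))"] DERIV_pen feasibleD(2)[OF assms(1)] by simp
  have 3: "((\<lambda>z. pen s (gap (fst z) (snd z) k)) has_derivative
      (\<lambda>h. side k * (fst (snd h) \<bullet> w $ k + fst p \<bullet> fst h $ k + snd (snd h)) * pen' s (gap w p k))) (at (w, p))" for k
    using DERIV_compose_FDERIV[OF _ has_derivative_gap[of k w p], of "pen s" "pen' s (gap w p k)"]
      DERIV_pen feasibleD(1)[OF assms(1)] by simp
  have "((\<lambda>z. energy s (fst z) (snd z)) has_derivative
     (\<lambda>h. - (fst (snd h) \<bullet> sgn (fst p)) * pen' s (1 - norm (fst p)) +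
       (\<Sum>k\<in>UNIV. side k * (fst (snd h) \<bullet> w $ k + fst p \<bullet> fst h $ k + snd (snd h)) * pen' s (gap w p k)))) (at (w, p))"
    unfolding energy_def by (intro has_derivative_add has_derivative_sum 2 3)
  moreover have "- (fst (snd h) \<bullet> sgn (fst p)) * pen' s (1 - norm (fst p)) +
       (\<Sum>k\<in>UNIV. side k * (fst (snd h) \<bullet> w $ k + fst p \<bullet> fst h $ k + snd (snd h)) * pen' s (gap w p k))
     = vertex_grad s w p \<bullet> fst h + plane_grad s w p \<bullet> snd h" for h
    by (simp add: vertex_grad_def plane_grad_def inner_vec_def[where 'b = "'m + 'm"] inner_prod_def inner_diff_left inner_sum_left inner_sum_right
        sum_distrib_left sum_distrib_right sum.distrib[symmetric] algebra_simps inner_commute)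
  ultimately show ?thesis by simp
qed

text \<open>Gaps are affine in the plane, so their penalties are convex; the norm term is convex
  because a decreasing convex function is composed with the concave map
  \<open>1 - norm\<close>.\<close>

lemma energy_above_tangent:
  fixes w :: "('m::finite) vertices"
  assumes "feasible w p" "feasible w q" "fst p \<noteq> 0"
  shows "energy s w p + plane_grad s w p \<bullet> (q - p) \<le> energy s w q"
proof -
  define a where "a = pen' s (1 - norm (fst p))"
  have "a \<le> 0" using feasibleD(2)[OF assms(1)] by (simp add: a_def pen'_nonpos)
  \<comment> \<open>The subgradient inequality of the norm: Cauchy-Schwarz with the unit vector
    \<open>sgn (fst p)\<close>, with equality at \<open>fst p\<close>.\<close>
  moreover have "sgn (fst p) \<bullet> (fst q - fst p) \<le> norm (fst q) - norm (fst p)"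
  proof -
    have "sgn (fst p) \<bullet> fst q \<le> norm (fst q)"
      using norm_cauchy_schwarz[of "sgn (fst p)" "fst q"] assms(3) by (simp add: norm_sgn)
    moreover have "sgn (fst p) \<bullet> fst p = norm (fst p)"
      using assms(3) by (simp add: sgn_div_norm power2_norm_eq_inner[symmetric] power2_eq_square)
    ultimately show ?thesis by (simp add: inner_diff_right)
  qed
  ultimately have "- a * (sgn (fst p) \<bullet> (fst q - fst p)) \<le> - a * (norm (fst q) - norm (fst p))"
    by (intro mult_left_mono) auto
  moreover have "pen s (1 - norm (fst p)) + a * ((1 - norm (fst q)) - (1 - norm (fst p))) \<le> pen s (1 - norm (fst q))"
    unfolding a_def by (rule pen_above_tangent) (use assms in \<open>auto simp: feasible_def\<close>)
  ultimately have 1: "pen s (1 - norm (fst p)) - a * (sgn (fst p) \<bullet> (fst q - fst p)) \<le> pen s (1 - norm (fst q))"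
    by (simp add: algebra_simps)
  have "(\<Sum>k\<in>UNIV. pen s (gap w p k) + pen' s (gap w p k) * (gap w q k - gap w p k)) \<le> (\<Sum>k\<in>UNIV. pen s (gap w q k))"
    by (intro sum_mono pen_above_tangent feasibleD assms)
  moreover have "plane_grad s w p \<bullet> (q - p) = (\<Sum>k\<in>UNIV. pen' s (gap w p k) * (gap w q k - gap w p k)) - a * (sgn (fst p) \<bullet> (fst q - fst p))"
  proof -
    define \<mu> where "\<mu> k = pen' s (gap w p k) * side k" for k
    have "pen' s (gap w p k) * (gap w q k - gap w p k) = \<mu> k *\<^sub>R w $ k \<bullet> (fst q - fst p) + \<mu> k * (snd q - snd p)" for k
      by (simp add: \<mu>_def gap_def algebra_simps inner_commute)
    then show ?thesis
      unfolding plane_grad_def a_def[symmetric] \<mu>_def[symmetric] inner_prod_def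
      by (simp add: inner_diff_left[of _ _ "fst q - fst p"] inner_sum_left sum_distrib_right sum.distrib)
  qed
  ultimately show ?thesis
    using 1 by (simp add: energy_def sum.distrib)
qed

lemma minimal_of_critical:
  assumes "feasible w p" "fst p \<noteq> 0" "plane_grad s w p = 0"
  shows "minimal s w p"
  using energy_above_tangent[OF assms(1) _ assms(2), of _ s] assms by (simp add: minimal_def)

lemma eventually_feasible:
  assumes "feasible w p"
  shows "\<forall>\<^sub>F u in nhds w. feasible u p" "\<forall>\<^sub>F q in nhds p. feasible w q"
proof -
  have "open ((\<lambda>u. (u, p)) -` {z. feasible (fst z) (snd z)})" "open ((\<lambda>q. (w, q)) -` {z. feasible (fst z) (snd z)})"
    by (intro open_vimage open_feasible continuous_intros)+
  from this[THEN eventually_nhds_in_open] assms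
  show "\<forall>\<^sub>F u in nhds w. feasible u p" "\<forall>\<^sub>F q in nhds p. feasible w q" by auto
qed

text \<open>Feasible planes form an open set, so a minimizer is interior and its derivative
  vanishes.\<close>

lemma plane_grad_minimal:
  fixes w :: "('m::finite) vertices"
  assumes "minimal s w p" "fst p \<noteq> 0"
  shows "plane_grad s w p = 0"
proof -
  have feas: "feasible w p" using assms by (simp add: minimal_def)
  have "((\<lambda>q. energy s (fst (w, q)) (snd (w, q))) has_derivative
      (\<lambda>h. vertex_grad s w p \<bullet> fst (0 :: 'm vertices, h) + plane_grad s w p \<bullet> snd (0 :: 'm vertices, h))) (at p)"
    by (rule has_derivative_compose[where f = "\<lambda>q. (w, q)", OF _ has_derivative_energy[OF feas assms(2)]])
      (auto intro!: derivative_eq_intros)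
  then have "(energy s w has_derivative (\<lambda>h. plane_grad s w p \<bullet> h)) (at p)" by simp
  moreover have "\<forall>\<^sub>F q in at p. energy s w p \<le> energy s w q"
    using eventually_feasible(2)[OF feas] assms(1) unfolding eventually_nhds_conv_at
    by (auto simp: minimal_def elim: eventually_mono)
  ultimately have "(\<lambda>h. plane_grad s w p \<bullet> h) = (\<lambda>h. 0)"
    by (rule has_derivative_local_min)
  then show ?thesis by (metis inner_eq_zero_iff)
qed

text \<open>Stationarity along the ray through \<open>p\<close>: all gap terms push outwards, so the norm
  term must push back. Along the ray the norm is differentiable even if the normal vanishes.\<close>

lemma minimal_norm_active:
  fixes w :: "('m::finite) vertices"
  assumes "minimal s w p" "0 < energy s w p"
  shows "1 - s < norm (fst p)"
proof (rule ccontr)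
  assume "\<not> 1 - s < norm (fst p)"
  then have n: "s \<le> 1 - norm (fst p)" by simp
  have feas: "feasible w p" using assms by (simp add: minimal_def)
  note f = feasibleD[OF feas]
  \<comment> \<open>Gaps are linear in the plane, so along the ray the energy is a function of
    \<open>t\<close> alone, with a local minimum at 1.\<close>
  have gap: "gap w (t *\<^sub>R p) k = t * gap w p k" for t k by (simp add: gap_def algebra_simps)
  let ?\<phi> = "\<lambda>t. pen s (1 - t * norm (fst p)) + (\<Sum>k\<in>UNIV. pen s (t * gap w p k))"
  have "(?\<phi> has_real_derivative pen' s (1 - 1 * norm (fst p)) * (- norm (fst p))
     + (\<Sum>k\<in>UNIV. pen' s (1 * gap w p k) * gap w p k)) (at 1)"
    using f by (intro derivative_intros DERIV_chain2[of "pen s"] DERIV_pen)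
      (auto intro!: derivative_eq_intros)
  moreover have "pen' s (1 - norm (fst p)) = 0"
    using pen'_eq_0_iff n f(2) by simp
  ultimately have "(?\<phi> has_real_derivative (\<Sum>k\<in>UNIV. pen' s (gap w p k) * gap w p k)) (at 1)"
    by simp
  moreover have "\<forall>\<^sub>F t in at 1. ?\<phi> 1 \<le> ?\<phi> t"
  proof -
    have "((\<lambda>t. t *\<^sub>R p) \<longlongrightarrow> 1 *\<^sub>R p) (at 1)" by (intro tendsto_intros)
    then have "\<forall>\<^sub>F t in at 1. feasible w (t *\<^sub>R p)"
      using eventually_feasible(2)[OF feas] by (simp add: filterlim_iff)
    moreover have "\<forall>\<^sub>F t::real in at 1. 0 < t"
      using order_tendstoD(1)[OF tendsto_ident_at, of 0 "1::real"] by simp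
    ultimately show ?thesis
    proof eventually_elim
      case (elim t)
      then have "energy s w p \<le> energy s w (t *\<^sub>R p)" using assms(1) unfolding minimal_def by blast
      then show ?case using elim by (simp add: energy_def gap)
    qed
  qed
  ultimately have "(\<lambda>h. (\<Sum>k\<in>UNIV. pen' s (gap w p k) * gap w p k) * h) = (\<lambda>h. 0)"
    unfolding has_field_derivative_def by (rule has_derivative_local_min)
  \<comment> \<open>The sign is flipped to get nonnegative summands: slopes are nonpositive and gaps
    positive. Each summand then vanishes, which puts every gap at \<open>s\<close> or beyond and
    makes the energy zero.\<close>
  from fun_cong[OF this, of 1] have "(\<Sum>k\<in>UNIV. - (pen' s (gap w p k) * gap w p k)) = 0"
    by (simp add: sum_negf)
  then have "pen' s (gap w p k) * gap w p k = 0" for k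
    using f(1) pen'_nonpos[OF f(1), of s]
    by (subst (asm) sum_nonneg_eq_0_iff) (auto simp: mult_nonpos_nonneg less_imp_le)
  then have "s \<le> gap w p k" for k
    using f(1)[of k] pen'_eq_0_iff[OF f(1), of s k] by (metis mult_eq_0_iff order_less_irrefl)
  then have "pen s (gap w p k) = 0" for k
    using f(1) pen_eq_0_iff by blast
  then have "energy s w p = 0"
    using n f(2) pen_eq_0_iff[of "1 - norm (fst p)" s] by (simp add: energy_def)
  then show False using assms by simp
qed

text \<open>With all gaps inactive, stationarity in the normal would consist of the norm term alone,
  which is nonzero because the norm exceeds \<open>1 - s\<close>.\<close>

lemma minimal_gap_active:
  fixes w :: "('m::finite) vertices"
  assumes "minimal s w p" "0 < energy s w p" "s < 1"
  obtains k where "gap w p k < s"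
proof (rule ccontr)
  assume *: "\<not> thesis"
  have feas: "feasible w p" using assms by (simp add: minimal_def)
  note f = feasibleD[OF feas]
  have g: "pen' s (gap w p k) = 0" for k
    using * that f(1) pen'_eq_0_iff by (meson not_le)
  have n: "1 - s < norm (fst p)" by (rule minimal_norm_active[OF assms(1,2)])
  then have n0: "fst p \<noteq> 0" using assms(3) by auto
  have "pen' s (1 - norm (fst p)) *\<^sub>R sgn (fst p) = 0"
    using plane_grad_minimal[OF assms(1) n0] by (simp add: plane_grad_def g zero_prod_def)
  then have "pen' s (1 - norm (fst p)) = 0" using n0 by (simp add: sgn_zero_iff)
  then show False using pen'_eq_0_iff[of "1 - norm (fst p)" s] n f(2) by auto
qed

section \<open>Second derivative in the plane and its nondegeneracy\<close>

definition plane_hess ::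
  "real \<Rightarrow> ('m::finite) vertices \<Rightarrow> plane \<Rightarrow> 'm vertices \<times> plane \<Rightarrow> plane" where
  "plane_hess s w p h =
    (let \<delta> = (\<lambda>k. side k * (fst (snd h) \<bullet> w $ k + fst p \<bullet> fst h $ k + snd (snd h)));
         e = fst (snd h) \<bullet> sgn (fst p) in
     ((\<Sum>k\<in>UNIV. (\<delta> k * pen'' s (gap w p k) * side k) *\<^sub>R w $ k + (pen' s (gap w p k) * side k) *\<^sub>R fst h $ k)
       + (e * pen'' s (1 - norm (fst p))) *\<^sub>R sgn (fst p)
       - (pen' s (1 - norm (fst p)) / norm (fst p)) *\<^sub>R (fst (snd h) - e *\<^sub>R sgn (fst p)),
      \<Sum>k\<in>UNIV. \<delta> k * pen'' s (gap w p k) * side k))"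

lemma has_derivative_pen'_gap:
  assumes "feasible w p"
  shows "((\<lambda>z. pen' s (gap (fst z) (snd z) k)) has_derivative
      (\<lambda>h. side k * (fst (snd h) \<bullet> w $ k + fst p \<bullet> fst h $ k + snd (snd h)) * pen'' s (gap w p k))) (at (w, p))"
  using DERIV_compose_FDERIV[OF _ has_derivative_gap[of k w p], of "pen' s" "pen'' s (gap w p k)"]
      DERIV_pen' feasibleD(1)[OF assms(1)] by simp

text \<open>The last term of the normal component comes from differentiating \<open>sgn\<close>:
  this gives the projection orthogonal to the normal, divided by its length. The scalar
  \<open>e\<close> is the radial part of the increment.\<close>

lemma has_derivative_plane_grad:
  fixes w :: "('m::finite) vertices"
  assumes "feasible w p" "fst p \<noteq> 0"
  shows "((\<lambda>z. plane_grad s (fst z) (snd z)) has_derivative plane_hess s w p) (at (w, p))"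
proof -
  define e where "e h = fst (snd h) \<bullet> sgn (fst p)" for h :: "'m vertices \<times> plane"
  note dn = has_derivative_norm_normal[OF assms(2), of w, folded e_def]
  have 1: "((\<lambda>z. 1 - norm (fst (snd z))) has_derivative (\<lambda>h. - e h)) (at (w, p))"
    by (rule derivative_eq_intros dn assms refl)+ simp
  have 2: "((\<lambda>z. pen' s (1 - norm (fst (snd z)))) has_derivative
      (\<lambda>h. - e h * pen'' s (1 - norm (fst p)))) (at (w, p))"
    using DERIV_compose_FDERIV[OF _ 1, of "pen' s" "pen'' s (1 - norm (fst p))"] DERIV_pen' feasibleD(2)[OF assms(1)] by simp
  have 3: "((\<lambda>z. sgn (fst (snd z))) has_derivative (\<lambda>h. (1 / norm (fst p)) *\<^sub>R (fst (snd h) - e h *\<^sub>R sgn (fst p)))) (at (w, p))"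
  proof -
    have "((\<lambda>z. (1 / norm (fst (snd z))) *\<^sub>R fst (snd z)) has_derivative
       (\<lambda>h. (1 / norm (fst p)) *\<^sub>R fst (snd h) + (- e h / (norm (fst p))\<^sup>2) *\<^sub>R fst p)) (at (w, p))"
      using assms(2) by (auto intro!: derivative_eq_intros dn simp: power2_eq_square)
    then show ?thesis
      by (simp add: sgn_div_norm divide_inverse power2_eq_square algebra_simps)
  qed
  have 4: "((\<lambda>z. pen' s (1 - norm (fst (snd z))) *\<^sub>R sgn (fst (snd z))) has_derivative
      (\<lambda>h. (pen' s (1 - norm (fst p)) / norm (fst p)) *\<^sub>R (fst (snd h) - e h *\<^sub>R sgn (fst p))
         - (e h * pen'' s (1 - norm (fst p))) *\<^sub>R sgn (fst p))) (at (w, p))"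
    by (rule has_derivative_eq_rhs[OF has_derivative_scaleR[OF 2 3]]) (simp add: algebra_simps)
  note g = has_derivative_pen'_gap[OF assms(1), of s]
  have 5: "((\<lambda>z. (pen' s (gap (fst z) (snd z) k) * side k) *\<^sub>R fst z $ k) has_derivative
     (\<lambda>h. (side k * (fst (snd h) \<bullet> w $ k + fst p \<bullet> fst h $ k + snd (snd h)) * pen'' s (gap w p k) * side k) *\<^sub>R w $ k
       + (pen' s (gap w p k) * side k) *\<^sub>R fst h $ k)) (at (w, p))" for k
    by (rule has_derivative_eq_rhs[OF has_derivative_scaleR[OF has_derivative_mult_left[OF g]
          bounded_linear.has_derivative[OF bounded_linear_vec_nth has_derivative_fst[OF has_derivative_ident]]]])
      auto
  show ?thesis
    unfolding plane_grad_def
    by (rule has_derivative_eq_rhs[OF has_derivative_Pair[OF has_derivative_diff[OF has_derivative_sum[OF 5] 4]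
           has_derivative_sum[OF has_derivative_mult_left[OF g]]]])
      (simp add: plane_hess_def Let_def e_def fun_eq_iff algebra_simps)
qed

lemma continuous_on_plane_hess:
  "continuous_on {z :: ('m::finite) vertices \<times> plane. feasible (fst z) (snd z) \<and> fst (snd z) \<noteq> 0}
     (\<lambda>z. plane_hess s (fst z) (snd z) h)" (is "continuous_on ?S _")
proof -
  have g: "continuous_on ?S (\<lambda>z. gap (fst z) (snd z) k)" for k
    unfolding gap_def by (intro continuous_intros)
  have sg: "continuous_on ?S (\<lambda>z. sgn (fst (snd z)))"
    unfolding sgn_div_norm by (intro continuous_intros) auto
  have p': "continuous_on ?S (\<lambda>z. pen' s (f z))"
    if "continuous_on ?S f" "\<And>z. z \<in> ?S \<Longrightarrow> 0 < f z" for f :: "_ \<Rightarrow> real"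
    unfolding pen'_def using that by (intro continuous_intros) (auto simp: order_less_imp_not_eq2)
  note p'' = continuous_on_pen''
  show ?thesis
    unfolding plane_hess_def Let_def
    by (intro continuous_intros g sg p' p'') (auto simp: feasible_def)
qed

text \<open>The quadratic form splits into three nonnegative parts. The curvature
  \<open>pen''\<close> of the norm term controls the radial increment of the normal, its slope
  \<open>- pen' / norm\<close> the tangential one, and a single active gap the offset.\<close>

lemma plane_hess_inj:
  fixes w :: "('m::finite) vertices"
  assumes s: "s < 1" and min: "minimal s w p" "0 < energy s w p" and zero: "plane_hess s w p (0, q) = 0"
  shows "q = 0"
proof -
  have feas: "feasible w p" using min by (simp add: minimal_def)
  note f = feasibleD[OF feas]
  have n: "1 - s < norm (fst p)" by (rule minimal_norm_active[OF min])
  then have n0: "fst p \<noteq> 0" using s by auto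
  define e where "e = fst q \<bullet> sgn (fst p)"
  define d where "d k = fst q \<bullet> w $ k + snd q" for k
  define A where "A = pen' s (1 - norm (fst p))"
  define B where "B = pen'' s (1 - norm (fst p))"
  have B: "0 < B" unfolding B_def using n f(2) by (intro pen''_pos) auto
  have A: "A < 0"
    using pen'_nonpos[of "1 - norm (fst p)" s] pen'_eq_0_iff[of "1 - norm (fst p)" s] n f(2) by (force simp: A_def)
  \<comment> \<open>Each sign occurs twice in the Hessian and cancels.\<close>
  have sq: "side k * x * y * side k = x * y" for k :: "'m + 'm" and x y :: real
    using side_square[of k] by algebra
  have hess: "plane_hess s w p (0, q) =
    ((\<Sum>k\<in>UNIV. (d k * pen'' s (gap w p k)) *\<^sub>R w $ k) + (e * B) *\<^sub>R sgn (fst p)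
       - (A / norm (fst p)) *\<^sub>R (fst q - e *\<^sub>R sgn (fst p)),
      \<Sum>k\<in>UNIV. d k * pen'' s (gap w p k))"
    by (simp add: plane_hess_def Let_def e_def d_def A_def B_def sq)
  have "plane_hess s w p (0, q) \<bullet> q =
     (\<Sum>k\<in>UNIV. (d k)\<^sup>2 * pen'' s (gap w p k)) + e\<^sup>2 * B + (- A / norm (fst p)) * ((norm (fst q))\<^sup>2 - e\<^sup>2)"
  proof -
    have "(\<Sum>k\<in>UNIV. (d k)\<^sup>2 * pen'' s (gap w p k))
       = (\<Sum>k\<in>UNIV. (d k * pen'' s (gap w p k)) *\<^sub>R w $ k) \<bullet> fst q + (\<Sum>k\<in>UNIV. d k * pen'' s (gap w p k)) * snd q"
      by (simp add: inner_sum_left sum_distrib_right sum.distrib[symmetric])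
        (simp add: d_def power2_eq_square algebra_simps inner_commute)
    then show ?thesis
      unfolding hess inner_prod_def
      by (simp add: inner_add_left inner_diff_left e_def[symmetric] inner_commute[of "sgn (fst p)"]
          dot_square_norm power2_eq_square algebra_simps)
  qed
  also have "plane_hess s w p (0, q) \<bullet> q = 0" using zero by simp
  finally have eq: "(\<Sum>k\<in>UNIV. (d k)\<^sup>2 * pen'' s (gap w p k)) + e\<^sup>2 * B + (- A / norm (fst p)) * ((norm (fst q))\<^sup>2 - e\<^sup>2) = 0"
    by simp
  have t: "0 \<le> (d k)\<^sup>2 * pen'' s (gap w p k)" for k
    using pen''_nonneg[OF f(1)] by simp
  have t1: "0 \<le> (\<Sum>k\<in>UNIV. (d k)\<^sup>2 * pen'' s (gap w p k))" by (intro sum_nonneg t)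
  have t2: "0 \<le> e\<^sup>2 * B" using B by simp
  \<comment> \<open>The radial part is at most the whole increment, so the tangential contribution
    is nonnegative.\<close>
  have "\<bar>e\<bar> \<le> norm (fst q)"
    using Cauchy_Schwarz_ineq2[of "fst q" "sgn (fst p)"] n0 by (simp add: e_def norm_sgn)
  then have e2: "e\<^sup>2 \<le> (norm (fst q))\<^sup>2" by (metis abs_ge_zero power2_abs power_mono)
  then have t3: "0 \<le> (- A / norm (fst p)) * ((norm (fst q))\<^sup>2 - e\<^sup>2)"
    using A by (intro mult_nonneg_nonneg divide_nonneg_nonneg) auto
  have "e\<^sup>2 * B = 0" "(- A / norm (fst p)) * ((norm (fst q))\<^sup>2 - e\<^sup>2) = 0"
    and S: "(\<Sum>k\<in>UNIV. (d k)\<^sup>2 * pen'' s (gap w p k)) = 0"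
    using eq t1 t2 t3 by linarith+
  then have "fst q = 0" using A B n0 by auto
  moreover obtain k where k: "gap w p k < s" using minimal_gap_active[OF min s] .
  have "(d k)\<^sup>2 * pen'' s (gap w p k) = 0"
    using S t by (simp add: sum_nonneg_eq_0_iff)
  \<comment> \<open>As the increment of the normal is already zero, \<open>d k\<close> is the
    increment of the offset.\<close>
  then have "d k = 0" using pen''_pos[OF f(1) k] by simp
  ultimately show ?thesis by (simp add: d_def prod_eq_iff)
qed

text \<open>A nonzero normal is built into the open domain, so the whole branch inherits it and
  every critical plane on it is a global minimizer.\<close>

lemma minimal_branch:
  fixes w0 :: "('m::finite) vertices"
  assumes s: "s < 1" and min: "minimal s w0 p0" "0 < energy s w0 p0"
  obtains U h where "open U" "w0 \<in> U"
    "\<And>w. w \<in> U \<Longrightarrow> minimal s w (h w) \<and> fst (h w) \<noteq> 0 \<and> h differentiable (at w)"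
proof -
  let ?S = "{z :: 'm vertices \<times> plane. feasible (fst z) (snd z) \<and> fst (snd z) \<noteq> 0}"
  have n0: "fst p0 \<noteq> 0" using minimal_norm_active[OF min] s by auto
  obtain U h where U: "open U" "w0 \<in> U"
    and h: "\<And>w. w \<in> U \<Longrightarrow> (w, h w) \<in> ?S \<and> plane_grad s (fst (w, h w)) (snd (w, h w)) = 0 \<and> h differentiable (at w)"
  proof (rule implicit_function_differentiable[of ?S w0 p0 "\<lambda>z. plane_grad s (fst z) (snd z)" "\<lambda>z. plane_hess s (fst z) (snd z)"])
    show "open ?S" by (rule open_feasible_nonzero)
    show "(w0, p0) \<in> ?S" using n0 min by (simp add: minimal_def)
    show "((\<lambda>z. plane_grad s (fst z) (snd z)) has_derivative plane_hess s (fst z) (snd z)) (at z)" if "z \<in> ?S" for z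
      using has_derivative_plane_grad[of "fst z" "snd z"] that by simp
    show "continuous_on ?S (\<lambda>z. plane_hess s (fst z) (snd z) v)" for v by (rule continuous_on_plane_hess)
    show "plane_grad s (fst (w0, p0)) (snd (w0, p0)) = 0" using plane_grad_minimal[OF min(1) n0] by simp
    show "q = 0" if "plane_hess s (fst (w0, p0)) (snd (w0, p0)) (0, q) = 0" for q
      using plane_hess_inj[OF s min] that by simp
  qed blast
  show thesis
    by (rule that[OF U, of h]) (use h minimal_of_critical[of _ "h _" s] in auto)
qed

lemma sum_UNIV_Plus:
  fixes f :: "'m::finite + 'm \<Rightarrow> 'c::comm_monoid_add"
  shows "(\<Sum>k\<in>UNIV. f k) = (\<Sum>m\<in>UNIV. f (Inl m)) + (\<Sum>m\<in>UNIV. f (Inr m))"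
  by (subst UNIV_Plus_UNIV[symmetric], subst sum.Plus) auto

subsection \<open>The contact potential and its gradient\<close>

text \<open>A vector as a sum of linear images of its components: differentiability of any order
  then passes through sums and linear maps.\<close>

lemma vec_lambda_eq_sum_axis: "(\<chi> k. g k) = (\<Sum>k\<in>UNIV. axis k (g k))"
  by (simp add: vec_eq_iff axis_def)

lemma bounded_linear_axis: "bounded_linear (axis k :: 'a::euclidean_space \<Rightarrow> 'a^'n)"
  by (auto intro!: linearI simp: linear_conv_bounded_linear[symmetric] vec_eq_iff axis_def)

lemma differentiable_vec_lambda:
  fixes f :: "'n::finite \<Rightarrow> 'a::real_normed_vector \<Rightarrow> 'b::euclidean_space"
  assumes "\<And>k. f k differentiable (at x)"
  shows "(\<lambda>x. \<chi> k. f k x) differentiable (at x)"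
  unfolding vec_lambda_eq_sum_axis
  by (intro differentiable_sum finite ballI
      differentiable_compose[OF bounded_linear_imp_differentiable[OF bounded_linear_axis]] assms)

text \<open>Both vertex families are packed into one Euclidean vector, the space in which
  derivatives with respect to all vertices at once are taken.\<close>

definition potential :: "real \<Rightarrow> ('m::finite) vertices \<Rightarrow> ereal" where
  "potential s w = world_contact_potential s (\<lambda>m. w $ Inl m) (\<lambda>m. w $ Inr m)"

abbreviation real_potential :: "real \<Rightarrow> ('m::finite) vertices \<Rightarrow> real" where
  "real_potential s w \<equiv> real_of_ereal (potential s w)"

text \<open>No barrier term is negative, so one infinite term makes the sum infinite; this happens
  exactly for infeasible planes.\<close>

lemma plane_potential_eq_energy:
  fixes w :: "('m::finite) vertices"
  shows "plane_potential s (\<lambda>m. hom4 (w $ Inl m) 1) (\<lambda>m. hom4 (w $ Inr m) 1) p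
    = (if feasible w p then ereal (energy s w p) else \<infinity>)"
proof -
  have eq: "plane_potential s (\<lambda>m. hom4 (w $ Inl m) 1) (\<lambda>m. hom4 (w $ Inr m) 1) p
    = barrier s (1 - norm (fst p)) + (\<Sum>k\<in>UNIV. barrier s (gap w p k))"
    unfolding plane_potential_def sum_UNIV_Plus
    by (simp add: case_prod_beta inner_hom4 gap_def side_def sum.distrib)
  show ?thesis
  proof (cases "feasible w p")
    case True
    then show ?thesis
      unfolding eq by (simp add: barrier_eq_pen feasible_def energy_def not_le[symmetric])
  next
    case False
    then consider "1 - norm (fst p) \<le> 0" | k where "gap w p k \<le> 0"
      by (auto simp: feasible_def not_less)
    then have "barrier s (1 - norm (fst p)) = \<infinity> \<or> (\<Sum>k\<in>UNIV. barrier s (gap w p k)) = \<infinity>"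
      by cases (auto simp: barrier_def sum_Pinfty)
    then show ?thesis using False
      unfolding eq by auto
  qed
qed

lemma potential_eq_INF:
  "potential s w = (INF p. if feasible w p then ereal (energy s w p) else \<infinity>)"
  by (simp add: potential_def world_contact_potential_def hom_contact_potential_def plane_potential_eq_energy)

lemma potential_nonneg: "0 \<le> potential s w"
  unfolding potential_eq_INF by (intro INF_greatest) (auto simp: energy_nonneg)

lemma potential_le_energy: "feasible w p \<Longrightarrow> potential s w \<le> ereal (energy s w p)"
  unfolding potential_eq_INF by (rule INF_lower2[of p]) auto

lemma potential_minimal:
  assumes "minimal s w p" shows "potential s w = ereal (energy s w p)"
proof (rule antisym)
  show "potential s w \<le> ereal (energy s w p)"
    using assms by (intro potential_le_energy) (simp add: minimal_def)
  show "ereal (energy s w p) \<le> potential s w"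
    unfolding potential_eq_INF using assms
    by (intro INF_greatest) (auto simp: minimal_def simp del: split_paired_All)
qed

lemma minimal_exists:
  assumes "0 < s" "potential s w < \<infinity>"
  obtains p where "minimal s w p"
proof -
  obtain p where p: "potential s w = (if feasible w p then ereal (energy s w p) else \<infinity>)"
    using world_contact_potential_attained[OF assms(1), of "\<lambda>m. w $ Inl m" "\<lambda>m. w $ Inr m"]
    unfolding potential_def[symmetric] plane_potential_eq_energy by blast
  with assms have "feasible w p" by (auto split: if_splits)
  moreover have "energy s w p \<le> energy s w q" if "feasible w q" for q
    using potential_le_energy[OF that, of s] p \<open>feasible w p\<close> by simp
  ultimately have "minimal s w p" by (simp add: minimal_def del: split_paired_All)
  then show thesis by (rule that)
qed

lemma potential_finite_iff:
  "\<bar>potential s w\<bar> \<noteq> \<infinity> \<longleftrightarrow> potential s w < \<infinity>"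
  using potential_nonneg[of s w] by (cases "potential s w") auto

lemma real_potential_le_energy: "feasible w p \<Longrightarrow> real_potential s w \<le> energy s w p"
  using potential_le_energy[of w p s] potential_nonneg[of s w] by (cases "potential s w") auto

text \<open>A fixed plane stays feasible under small motions of the vertices, so finiteness is an
  open condition.\<close>

lemma eventually_potential_finite:
  assumes "feasible w p"
  shows "\<forall>\<^sub>F u in nhds w. potential s u < \<infinity>"
  using eventually_feasible(1)[OF assms]
  by eventually_elim (rule le_less_trans[OF potential_le_energy], auto)

text \<open>Envelope theorem: the energy of a fixed plane touches the potential from above.\<close>

lemma real_potential_derivative:
  fixes w :: "('m::finite) vertices"
  assumes min: "minimal s w p" and n0: "fst p \<noteq> 0" and der: "(real_potential s has_derivative D) (at w)"
  shows "D = (\<lambda>h. vertex_grad s w p \<bullet> h)"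
proof -
  have feas: "feasible w p" using min by (simp add: minimal_def)
  have "((\<lambda>u. energy s (fst (u, p)) (snd (u, p))) has_derivative
      (\<lambda>h. vertex_grad s w p \<bullet> fst (h, 0 :: plane) + plane_grad s w p \<bullet> snd (h, 0 :: plane))) (at w)"
    by (rule has_derivative_compose[where f = "\<lambda>u. (u, p)", OF _ has_derivative_energy[OF feas n0]])
      (auto intro!: derivative_eq_intros)
  then have "((\<lambda>u. energy s u p - real_potential s u) has_derivative (\<lambda>h. vertex_grad s w p \<bullet> h - D h)) (at w)"
    by (intro has_derivative_diff der) simp
  moreover have "\<forall>\<^sub>F u in at w. energy s w p - real_potential s w \<le> energy s u p - real_potential s u"
    using eventually_feasible(1)[OF feas] unfolding eventually_nhds_conv_at
    by (auto simp: potential_minimal[OF min] elim!: eventually_mono dest: real_potential_le_energy[of _ _ s])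
  ultimately have "(\<lambda>h. vertex_grad s w p \<bullet> h - D h) = (\<lambda>h. 0)"
    by (rule has_derivative_local_min)
  then show ?thesis by (simp add: fun_eq_iff)
qed

text \<open>The plane is frozen while the vertices move. Its gaps start at \<open>s\<close> or more
  and, the normal being shorter than 1, fall by at most \<open>r = norm (u - w)\<close>, so each
  penalty has a numerator of at most \<open>r^4\<close>.\<close>

lemma energy_quartic_bound:
  fixes w :: "('m::finite) vertices"
  assumes s: "0 < s" and feas: "feasible w p" and zero: "energy s w p = 0"
  obtains K where "0 \<le> K"
    "\<forall>\<^sub>F u in nhds w. feasible u p \<and> energy s u p \<le> K * norm (u - w) ^ 4"
proof (rule that)
  \<comment> \<open>One contribution per vertex of either polyhedron; the radius
    \<open>s / 2\<close> chosen below keeps every gap above \<open>s / 2\<close>, which bounds the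
    denominators.\<close>
  let ?K = "CARD('m + 'm) * (1 / (s / 2) ^ 5)"
  show "0 \<le> ?K" using s by simp
  show "\<forall>\<^sub>F u in nhds w. feasible u p \<and> energy s u p \<le> ?K * norm (u - w) ^ 4"
  proof (rule eventually_mono[OF eventually_nhds_in_open[of "ball w (s / 2)" w]])
    fix u assume u: "u \<in> ball w (s / 2)"
    define r where "r = norm (u - w)"
    have r: "r < s / 2" using u by (simp add: r_def dist_norm norm_minus_commute)
    have gap: "s - r \<le> gap u p k" for k
    proof -
      have "\<bar>fst p \<bullet> (u $ k - w $ k)\<bar> \<le> norm (fst p) * norm ((u - w) $ k)"
        using Cauchy_Schwarz_ineq2[of "fst p" "u $ k - w $ k"] by simp
      also have "\<dots> \<le> 1 * r"
        unfolding r_def using feasibleD(2)[OF feas] Finite_Cartesian_Product.norm_nth_le[of "u - w" k] by (intro mult_mono) auto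
      finally have "\<bar>side k * (fst p \<bullet> (u $ k - w $ k))\<bar> \<le> r" by (simp add: abs_mult)
      moreover have "gap u p k = gap w p k + side k * (fst p \<bullet> (u $ k - w $ k))"
        by (simp add: gap_def algebra_simps)
      ultimately show ?thesis using energy_eq_0D(1)[OF feas zero, of k] by linarith
    qed
    have pos: "s / 2 < gap u p k" for k using gap[of k] r by linarith
    have pen: "pen s (gap u p k) \<le> 1 / (s / 2) ^ 5 * r ^ 4" for k
    proof -
      have "pen s (gap u p k) \<le> r ^ 4 / (s / 2) ^ 5"
        unfolding pen_def
      proof (rule frac_le)
        show "max 0 (s - gap u p k) ^ 4 \<le> r ^ 4"
          using gap[of k] by (intro power_mono) (auto simp: r_def)
        show "(s / 2) ^ 5 \<le> gap u p k ^ 5" using pos[of k] s by (intro power_mono) auto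
      qed (use s in auto)
      then show ?thesis by simp
    qed
    have "0 < gap u p k" for k using pos[of k] s by linarith
    then have "feasible u p" using feasibleD(2)[OF feas] by (simp add: feasible_def)
    \<comment> \<open>The norm term does not see the vertices and stays zero.\<close>
    moreover have "pen s (1 - norm (fst p)) = 0"
      using energy_eq_0D(2)[OF feas zero] feasibleD(2)[OF feas] pen_eq_0_iff[of "1 - norm (fst p)" s] by simp
    then have "energy s u p \<le> ?K * r ^ 4"
      using sum_bounded_above[of UNIV "\<lambda>k. pen s (gap u p k)", OF pen] by (simp add: energy_def)
    ultimately show "feasible u p \<and> energy s u p \<le> ?K * norm (u - w) ^ 4" by (simp add: r_def)
  qed (use s in auto)
qed

lemma vertex_grad_zero:
  assumes "feasible w p" "energy s w p = 0"
  shows "vertex_grad s w p = 0"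
  using energy_eq_0D(1)[OF assms] pen'_eq_0_iff[OF feasibleD(1)[OF assms(1)]]
  by (simp add: vertex_grad_def vec_eq_iff)

lemma gderiv_potential:
  fixes w :: "('m::finite) vertices"
  assumes s: "0 < s" "s < 1" and min: "minimal s w p"
  shows "GDERIV (real_potential s) w :> vertex_grad s w p"
proof (cases "energy s w p = 0")
  case True
  have feas: "feasible w p" using min by (simp add: minimal_def)
  obtain K where K: "0 \<le> K" "\<forall>\<^sub>F u in nhds w. feasible u p \<and> energy s u p \<le> K * norm (u - w) ^ 4"
    using energy_quartic_bound[OF s(1) feas True] .
  have zero: "real_potential s w = 0" by (simp add: potential_minimal[OF min] True)
  have "\<forall>\<^sub>F u in nhds w. norm (real_potential s u - real_potential s w) \<le> K * (norm (u - w))\<^sup>2"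
    using K(2) eventually_nhds_in_open[OF open_ball, of w w 1, simplified]
  proof eventually_elim
    case (elim u)
    have "real_potential s u \<le> K * norm (u - w) ^ 4"
      using real_potential_le_energy[of u p s] elim by linarith
    also have "\<dots> \<le> K * (norm (u - w))\<^sup>2"
      using elim(2) by (intro mult_left_mono K power_decreasing) (auto simp: dist_norm norm_minus_commute)
    finally show ?case
      using real_of_ereal_pos[OF potential_nonneg, of s u] unfolding zero
      by (simp only: real_norm_def diff_zero abs_of_nonneg)
  qed
  from has_derivative_zero_of_quadratic_bound[OF this] show ?thesis
    by (simp add: gderiv_def vertex_grad_zero[OF feas True])
next
  case False
  have feas: "feasible w p" using min by (simp add: minimal_def)
  then have pos: "0 < energy s w p" using False energy_nonneg[OF feas, of s] by simp
  obtain U h where U: "open U" "w \<in> U"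
    and h: "\<And>u. u \<in> U \<Longrightarrow> minimal s u (h u) \<and> fst (h u) \<noteq> 0 \<and> h differentiable (at u)"
    using minimal_branch[OF s(2) min pos] by metis
  have "feasible w (h w)" using h[OF U(2)] by (simp add: minimal_def)
  have "(\<lambda>u. energy s (fst (u, h u)) (snd (u, h u))) differentiable (at w)"
  proof (rule differentiable_compose[where f = "\<lambda>z. energy s (fst z) (snd z)"])
    show "(\<lambda>z. energy s (fst z) (snd z)) differentiable (at (w, h w))"
      by (rule differentiableI[OF has_derivative_energy]) (use h[OF U(2)] in \<open>auto simp: minimal_def\<close>)
    show "(\<lambda>u. (u, h u)) differentiable (at w)"
      using h[OF U(2)] by (auto simp: differentiable_def intro: has_derivative_Pair[OF has_derivative_ident])
  qed
  then obtain D where "((\<lambda>u. energy s u (h u)) has_derivative D) (at w)"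
    by (auto simp: differentiable_def)
  then have "(real_potential s has_derivative D) (at w)"
    by (rule has_derivative_transform_within_open[OF _ U]) (metis h potential_minimal real_of_ereal.simps(1))
  \<comment> \<open>The branch supplies only differentiability. The formula for the given minimizer
    \<open>p\<close>, which is not known to be \<open>h w\<close>, comes from the envelope
    lemma.\<close>
  moreover have "fst p \<noteq> 0" using minimal_norm_active[OF min pos] s by auto
  ultimately show ?thesis
    using real_potential_derivative[OF min] by (simp add: gderiv_def inner_commute)
qed

lemma GDERIV_unique:
  assumes "GDERIV f x :> a" "GDERIV f x :> b" shows "a = b"
proof -
  have "(\<lambda>h. h \<bullet> a) = (\<lambda>h. h \<bullet> b)"
    using assms unfolding gderiv_def by (rule has_derivative_unique)
  then show ?thesis by (metis vector_eq_ldot)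
qed

definition potential_grad :: "real \<Rightarrow> ('m::finite) vertices \<Rightarrow> 'm vertices" where
  "potential_grad s w = vertex_grad s w (SOME p. minimal s w p)"

text \<open>Two minimizers yield gradients of the same function at the same point, and gradients are
  unique.\<close>

lemma potential_grad_eq:
  assumes s: "0 < s" "s < 1" and min: "minimal s w p"
  shows "potential_grad s w = vertex_grad s w p"
  unfolding potential_grad_def
  using GDERIV_unique[OF gderiv_potential[OF s someI[of "minimal s w", OF min]] gderiv_potential[OF s min]] .

lemma norm_vec_le_sum: "norm x \<le> (\<Sum>k\<in>UNIV. norm (x $ k))"
  unfolding norm_vec_def by (rule L2_set_le_sum) simp

text \<open>At positive energy the gradient is a differentiable expression along the branch. At
  energy zero it vanishes and is \<open>O(r^2)\<close> nearby, so its derivative is zero.\<close>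

lemma potential_grad_differentiable:
  fixes w :: "('m::finite) vertices"
  assumes s: "0 < s" "s < 1" and min: "minimal s w p"
  shows "potential_grad s differentiable (at w)"
proof (cases "energy s w p = 0")
  case True
  have feas: "feasible w p" using min by (simp add: minimal_def)
  obtain K where K: "0 \<le> K" "\<forall>\<^sub>F u in nhds w. feasible u p \<and> energy s u p \<le> K * norm (u - w) ^ 4"
    using energy_quartic_bound[OF s(1) feas True] .
  obtain \<delta> C where \<delta>: "0 < \<delta>" and C: "0 \<le> C"
    and pen': "\<And>x. 0 < x \<Longrightarrow> pen s x < \<delta> \<Longrightarrow> \<bar>pen' s x\<bar> \<le> C * sqrt (pen s x)"
    using abs_pen'_le_sqrt_pen[OF s(1)] by metis
  have zero: "potential_grad s w = 0"
    using potential_grad_eq[OF s min] vertex_grad_zero[OF feas True] by simp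
  have "((\<lambda>u. K * norm (u - w) ^ 4) \<longlongrightarrow> K * norm (w - w) ^ 4) (nhds w)"
    by (intro tendsto_intros filterlim_ident)
  \<comment> \<open>This brings every penalty below the threshold under which \<open>pen'\<close> is
    controlled by the square root of \<open>pen\<close>.\<close>
  then have small: "\<forall>\<^sub>F u in nhds w. K * norm (u - w) ^ 4 < \<delta>"
    using \<delta> by (intro order_tendstoD) auto
  have "\<forall>\<^sub>F u in nhds w. norm (potential_grad s u - potential_grad s w)
      \<le> (CARD('m + 'm) * (C * sqrt K)) * (norm (u - w))\<^sup>2"
    using K(2) small
  proof eventually_elim
    case (elim u)
    have "potential s u < \<infinity>"
      using potential_le_energy[of u p s] elim by (auto intro: le_less_trans)
    then obtain q where q: "minimal s u q" using minimal_exists[OF s(1)] by blast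
    then have fq: "feasible u q" and "energy s u q \<le> energy s u p"
      using elim by (auto simp: minimal_def simp del: split_paired_All)
    \<comment> \<open>The minimizer \<open>q\<close> for the moved vertices costs no more than the
      old plane \<open>p\<close>, which is still feasible.\<close>
    then have e: "energy s u q \<le> K * norm (u - w) ^ 4" using elim by linarith
    have "norm (potential_grad s u $ k) \<le> C * sqrt K * (norm (u - w))\<^sup>2" for k
    proof -
      have pen: "pen s (gap u q k) \<le> K * norm (u - w) ^ 4"
        using pen_gap_le_energy[OF fq, of s k] e by linarith
      have "norm (potential_grad s u $ k) = \<bar>pen' s (gap u q k)\<bar> * norm (fst q)"
        by (simp add: potential_grad_eq[OF s q] vertex_grad_def abs_mult)
      also have "\<dots> \<le> \<bar>pen' s (gap u q k)\<bar> * 1"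
        using feasibleD(2)[OF fq] by (intro mult_left_mono) auto
      also have "\<dots> \<le> C * sqrt (pen s (gap u q k))"
        using pen' feasibleD(1)[OF fq] pen elim(2) by simp
      also have "\<dots> \<le> C * sqrt (K * norm (u - w) ^ 4)"
        using pen C by (intro mult_left_mono) auto
      also have "sqrt (K * norm (u - w) ^ 4) = sqrt K * (norm (u - w))\<^sup>2"
        using real_sqrt_abs[of "(norm (u - w))\<^sup>2"] by (simp add: real_sqrt_mult)
      finally show ?thesis by simp
    qed
    then have "(\<Sum>k\<in>UNIV. norm (potential_grad s u $ k)) \<le> CARD('m + 'm) * (C * sqrt K * (norm (u - w))\<^sup>2)"
      by (rule sum_bounded_above)
    then show ?case
      using norm_vec_le_sum[of "potential_grad s u"] by (simp add: zero)
  qed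
  from has_derivative_zero_of_quadratic_bound[OF this] show ?thesis by (rule differentiableI)
next
  case False
  have feas: "feasible w p" using min by (simp add: minimal_def)
  then have pos: "0 < energy s w p" using False energy_nonneg[OF feas, of s] by simp
  obtain U h where U: "open U" "w \<in> U"
    and h: "\<And>u. u \<in> U \<Longrightarrow> minimal s u (h u) \<and> fst (h u) \<noteq> 0 \<and> h differentiable (at u)"
    using minimal_branch[OF s(2) min pos] by metis
  have feas': "feasible w (h w)" using h[OF U(2)] by (simp add: minimal_def)
  have dh: "(\<lambda>u. (u, h u)) differentiable (at w)"
    using h[OF U(2)] by (auto simp: differentiable_def intro: has_derivative_Pair[OF has_derivative_ident])
  have "(\<lambda>u. pen' s (gap (fst (u, h u)) (snd (u, h u)) k)) differentiable (at w)" for k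
    by (rule differentiable_compose[where f = "\<lambda>z. pen' s (gap (fst z) (snd z) k)", OF
          differentiableI[OF has_derivative_pen'_gap[OF feas']] dh])
  then have "(\<lambda>u. pen' s (gap u (h u) k)) differentiable (at w)" for k by simp
  moreover have "(\<lambda>u. fst (h u)) differentiable (at w)"
    using h[OF U(2)] by (auto simp: differentiable_def intro: has_derivative_fst)
  ultimately have "(\<lambda>u. (pen' s (gap u (h u) k) * side k) *\<^sub>R fst (h u)) differentiable (at w)" for k
    by (intro differentiable_scaleR differentiable_mult) auto
  then have "(\<lambda>u. vertex_grad s u (h u)) differentiable (at w)"
    unfolding vertex_grad_def by (rule differentiable_vec_lambda)
  then obtain D where "((\<lambda>u. vertex_grad s u (h u)) has_derivative D) (at w)"
    by (auto simp: differentiable_def)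
  then have "(potential_grad s has_derivative D) (at w)"
    by (rule has_derivative_transform_within_open[OF _ U]) (metis h potential_grad_eq[OF s])
  then show ?thesis by (rule differentiableI)
qed

text \<open>The total force is the offset component of \<open>plane_grad\<close> times the normal,
  hence 0. The total torque is the cross product of the weighted vertex sum with the normal;
  stationarity in the normal makes that sum parallel to the normal.\<close>

lemma momentum_balance:
  fixes w :: "('m::finite) vertices"
  assumes s: "0 < s" "s < 1" and min: "minimal s w p"
  shows "(\<Sum>k\<in>UNIV. vertex_grad s w p $ k) = 0"
    and "(\<Sum>k\<in>UNIV. cross3 (w $ k) (vertex_grad s w p $ k)) = 0"
proof -
  have feas: "feasible w p" using min by (simp add: minimal_def)
  have "(\<Sum>k\<in>UNIV. vertex_grad s w p $ k) = 0 \<and>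
     (\<Sum>k\<in>UNIV. cross3 (w $ k) (vertex_grad s w p $ k)) = 0"
  proof (cases "energy s w p = 0")
    case True
    then show ?thesis by (simp add: vertex_grad_zero[OF feas])
  next
    case False
    then have "0 < energy s w p" using energy_nonneg[OF feas, of s] by simp
    then have "fst p \<noteq> 0" using minimal_norm_active[OF min] s by auto
    from plane_grad_minimal[OF min this]
    have force: "(\<Sum>k\<in>UNIV. pen' s (gap w p k) * side k) = 0"
      and torque: "(\<Sum>k\<in>UNIV. (pen' s (gap w p k) * side k) *\<^sub>R w $ k) = pen' s (1 - norm (fst p)) *\<^sub>R sgn (fst p)"
      by (auto simp: plane_grad_def zero_prod_def)
    have "(\<Sum>k\<in>UNIV. vertex_grad s w p $ k) = (\<Sum>k\<in>UNIV. pen' s (gap w p k) * side k) *\<^sub>R fst p"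
      by (simp add: vertex_grad_def scaleR_sum_left)
    moreover have "(\<Sum>k\<in>UNIV. cross3 (w $ k) (vertex_grad s w p $ k))
      = cross3 (\<Sum>k\<in>UNIV. (pen' s (gap w p k) * side k) *\<^sub>R w $ k) (fst p)"
      by (simp add: vertex_grad_def cross_mult_left cross_mult_right
          linear_sum[OF bilinear_cross[unfolded bilinear_def, THEN conjunct2, rule_format]])
    moreover have "cross3 (sgn (fst p)) (fst p) = 0"
      by (simp add: sgn_div_norm cross_mult_left)
    ultimately show ?thesis by (simp add: force torque cross_mult_left)
  qed
  then show "(\<Sum>k\<in>UNIV. vertex_grad s w p $ k) = 0"
    and "(\<Sum>k\<in>UNIV. cross3 (w $ k) (vertex_grad s w p $ k)) = 0" by auto
qed

text \<open>Moving one vertex is an affine path in the joint vertex space, so the chain rule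
  extracts one block of the full gradient.\<close>

lemma potential_gradient_component:
  fixes w :: "('m::finite) vertices"
  assumes s: "0 < s" "s < 1" and min: "minimal s w p"
  shows "ereal_has_gradient (\<lambda>v. potential s (w + axis k (v - w $ k))) (w $ k) (vertex_grad s w p $ k)"
proof -
  let ?a = "\<lambda>v. w + axis k (v - w $ k)"
  have feas: "feasible w p" using min by (simp add: minimal_def)
  have a: "(?a has_derivative axis k) (at v)" for v
    by (rule has_derivative_eq_rhs[OF has_derivative_add[OF has_derivative_const
            bounded_linear.has_derivative[OF bounded_linear_axis has_derivative_diff[OF has_derivative_ident has_derivative_const]]]])
      auto
  have a0: "axis k (w $ k - w $ k) = 0" by (simp add: vec_eq_iff axis_def)
  have "(?a \<longlongrightarrow> ?a (w $ k)) (nhds (w $ k))"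
    using has_derivative_continuous[OF a, of "w $ k"] by (intro tendsto_at_iff_tendsto_nhds[of ?a, THEN iffD1]) (simp only: isCont_def)
  then have "\<forall>\<^sub>F v in nhds (w $ k). \<bar>potential s (?a v)\<bar> \<noteq> \<infinity>"
    unfolding potential_finite_iff a0 add_0_right
    by (rule eventually_compose_filterlim[OF eventually_potential_finite[OF feas, of s]])
  moreover have "((\<lambda>v. real_potential s (?a v)) has_derivative (\<lambda>h. axis k h \<bullet> vertex_grad s w p)) (at (w $ k))"
    using gderiv_potential[OF s min, unfolded gderiv_def]
    by (intro has_derivative_compose[OF a]) (simp only: a0 add_0_right)
  ultimately show ?thesis
    by (simp add: ereal_has_gradient_def gderiv_def inner_axis')
qed

subsection \<open>Separation and contact\<close>

text \<open>A plane of energy zero is exhibited: its normal points from \<open>a\<close> to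
  \<open>b\<close>, closest points of the two hulls, and has length \<open>1 - s\<close>.\<close>

lemma potential_zero_of_setdist:
  fixes w :: "('m::finite) vertices"
  assumes s: "0 < s" "s < 1"
    and dist: "2 * s / (1 - s) \<le> setdist (convex hull range (\<lambda>m. w $ Inl m)) (convex hull range (\<lambda>m. w $ Inr m))"
  shows "potential s w = 0"
proof -
  let ?A = "convex hull range (\<lambda>m. w $ Inl m)" and ?B = "convex hull range (\<lambda>m. w $ Inr m)"
  have cp: "compact ?A" "compact ?B" by (auto intro!: finite_imp_compact_convex_hull)
  moreover have "?A \<noteq> {}" "?B \<noteq> {}" by auto
  ultimately obtain a b where ab: "a \<in> ?A" "b \<in> ?B" "dist a b = setdist ?A ?B"
    using setdist_compact_closed compact_imp_closed by metis
  define D where "D = dist a b"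
  have "0 < 2 * s / (1 - s)" using s by simp
  then have D: "0 < D" "2 * s / (1 - s) \<le> D" using dist ab(3) by (auto simp: D_def)
  then have Ds: "2 * s \<le> (1 - s) * D" using s by (simp add: divide_simps mult.commute)
  define n where "n = ((1 - s) / D) *\<^sub>R (b - a)"
  \<comment> \<open>This offset puts the plane through the midpoint of \<open>a\<close> and
    \<open>b\<close>, so both sides get the gap \<open>(1 - s) * D / 2\<close>.\<close>
  define c where "c = - (n \<bullet> (a + b)) / 2"
  have nD: "norm n = 1 - s" using D s by (simp add: n_def D_def dist_norm norm_minus_commute)
  have nab: "n \<bullet> (b - a) = (1 - s) * D"
    using D by (simp add: n_def D_def dist_norm norm_minus_commute power2_norm_eq_inner[symmetric] power2_eq_square)
  \<comment> \<open>The variational inequality at a closest point: the hull lies behind the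
    supporting plane at \<open>a\<close>. The same holds for \<open>B\<close> at
    \<open>b\<close>.\<close>
  have A: "n \<bullet> x \<le> n \<bullet> a" if "x \<in> ?A" for x
  proof -
    have "(b - a) \<bullet> (x - a) \<le> 0"
      by (rule any_closest_point_dot[OF convex_convex_hull compact_imp_closed[OF cp(1)] ab(1) that])
        (use setdist_le_dist[OF _ ab(2)] ab(3) in \<open>auto simp: dist_commute\<close>)
    then have "((1 - s) / D) * ((b - a) \<bullet> (x - a)) \<le> 0" using D s by (intro mult_nonneg_nonpos) auto
    then show ?thesis by (simp add: n_def inner_diff_right right_diff_distrib)
  qed
  have B: "n \<bullet> b \<le> n \<bullet> x" if "x \<in> ?B" for x
  proof -
    have "(a - b) \<bullet> (x - b) \<le> 0"
      by (rule any_closest_point_dot[OF convex_convex_hull compact_imp_closed[OF cp(2)] ab(2) that])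
        (use setdist_le_dist[OF ab(1)] ab(3) in auto)
    then have "((1 - s) / D) * ((a - b) \<bullet> (x - b)) \<le> 0" using D s by (intro mult_nonneg_nonpos) auto
    then show ?thesis by (simp add: n_def algebra_simps inner_diff_left)
  qed
  have gap: "s \<le> gap w (n, c) k" for k
  proof (cases k)
    case (Inl m)
    have "n \<bullet> w $ Inl m \<le> n \<bullet> a" by (rule A) (auto intro: hull_inc)
    then show ?thesis using nab Ds Inl by (simp add: gap_def side_def c_def inner_add_right inner_diff_right field_simps)
  next
    case (Inr m)
    have "n \<bullet> b \<le> n \<bullet> w $ Inr m" by (rule B) (auto intro: hull_inc)
    then show ?thesis using nab Ds Inr by (simp add: gap_def side_def c_def inner_add_right inner_diff_right field_simps)
  qed
  then have pos: "0 < gap w (n, c) k" for k using s(1) less_le_trans by blast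
  have feas: "feasible w (n, c)" using pos nD s by (simp add: feasible_def)
  have "pen s (gap w (n, c) k) = 0" for k using pen_eq_0_iff[OF pos] gap by blast
  moreover have "pen s (1 - norm n) = 0" using pen_eq_0_iff[of s s] s by (simp add: nD)
  ultimately have "energy s w (n, c) = 0" by (simp add: energy_def)
  then show ?thesis
    using potential_le_energy[OF feas, of s] potential_nonneg[of s w] by (simp add: antisym zero_ereal_def)
qed

text \<open>If all gaps exceeded \<open>dist a b\<close>, each hull would lie in a half-space beyond
  that margin, since its generators do. The two margins add up to \<open>2 * dist a b\<close>, while
  a normal shorter than 1 allows at most \<open>dist a b\<close>.\<close>

lemma feasible_gap_le_dist:
  fixes w :: "('m::finite) vertices"
  assumes feas: "feasible w p"
    and a: "a \<in> convex hull range (\<lambda>m. w $ Inl m)" and b: "b \<in> convex hull range (\<lambda>m. w $ Inr m)"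
  obtains k where "gap w p k \<le> dist a b"
proof (rule ccontr)
  assume "\<not> thesis"
  then have *: "dist a b < gap w p k" for k using that not_le by blast
  have "convex hull range (\<lambda>m. w $ Inl m) \<subseteq> {x. fst p \<bullet> x < - snd p - dist a b}"
    using *[of "Inl _"] by (intro hull_minimal convex_halfspace_lt) (auto simp: gap_def side_def algebra_simps)
  moreover have "convex hull range (\<lambda>m. w $ Inr m) \<subseteq> {x. fst p \<bullet> x > dist a b - snd p}"
    using *[of "Inr _"] by (intro hull_minimal convex_halfspace_gt) (auto simp: gap_def side_def algebra_simps)
  ultimately have "fst p \<bullet> a < - snd p - dist a b" "fst p \<bullet> b > dist a b - snd p"
    using a b by blast+
  then have "2 * dist a b < fst p \<bullet> (b - a)"
    unfolding inner_diff_right by linarith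
  also have "\<dots> \<le> norm (fst p) * norm (b - a)" by (rule norm_cauchy_schwarz)
  also have "\<dots> \<le> 1 * dist a b"
    using feasibleD(2)[OF feas] by (intro mult_mono) (auto simp: dist_norm norm_minus_commute)
  finally show False using zero_le_dist[of a b] by linarith
qed

text \<open>Every feasible plane has a gap below \<open>r\<close>, and the penalty is decreasing;
  this drives the blow-up at contact.\<close>

lemma potential_lower_bound:
  fixes w :: "('m::finite) vertices"
  assumes r: "setdist (convex hull range (\<lambda>m. w $ Inl m)) (convex hull range (\<lambda>m. w $ Inr m)) < r"
  shows "ereal (pen s r) \<le> potential s w"
  unfolding potential_eq_INF
proof (intro INF_greatest)
  fix p
  show "ereal (pen s r) \<le> (if feasible w p then ereal (energy s w p) else \<infinity>)"
  proof (cases "feasible w p")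
    case True
    have "convex hull range (\<lambda>m. w $ Inl m) \<noteq> {}" "convex hull range (\<lambda>m. w $ Inr m) \<noteq> {}" by auto
    from setdist_ltE[OF r this] obtain a b where ab: "a \<in> convex hull range (\<lambda>m. w $ Inl m)"
      "b \<in> convex hull range (\<lambda>m. w $ Inr m)" "dist a b < r" by blast
    obtain k where "gap w p k \<le> dist a b" using feasible_gap_le_dist[OF True ab(1,2)] .
    then have "pen s r \<le> pen s (gap w p k)"
      using ab(3) by (intro pen_antimono feasibleD(1)[OF True]) auto
    then show ?thesis using True pen_gap_le_energy[OF True, of s k] by simp
  qed simp
qed

text \<open>The extended barrier is continuous at 0 with value \<open>\<infinity>\<close>, so it
  exceeds any bound just to the right of 0.\<close>

lemma pen_large:
  assumes "0 < s" obtains r where "0 < r" "B < pen s r"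
proof -
  have "((\<lambda>x. barrier s x) \<longlongrightarrow> barrier s 0) (at 0)"
    using continuous_barrier[OF assms] by (simp add: isCont_def)
  then have "\<forall>\<^sub>F x in at_right 0. ereal B < barrier s x"
    by (intro order_tendstoD(1)[OF tendsto_within_subset]) (auto simp: barrier_def)
  moreover have "\<forall>\<^sub>F x::real in at_right 0. 0 < x" by (simp add: eventually_at_right_less)
  ultimately have "\<exists>x. ereal B < barrier s x \<and> 0 < x"
    by (intro eventually_happens'[of "at_right (0::real)"] eventually_conj) auto
  then show thesis using that by (auto simp: barrier_eq_pen not_le[symmetric])
qed

subsection \<open>Twice differentiable maps\<close>

definition twice_differentiable :: "('a::real_normed_vector \<Rightarrow> 'b::real_normed_vector) \<Rightarrow> bool" where
  "twice_differentiable f \<longleftrightarrow> (\<exists>D :: 'a \<Rightarrow> ('a \<Rightarrow>\<^sub>L 'b).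
     \<forall>x. (f has_derivative blinfun_apply (D x)) (at x) \<and> D differentiable (at x))"

lemma differentiable_blinfun_compose:
  assumes "f differentiable (at x)" "g differentiable (at x)"
  shows "(\<lambda>x. f x o\<^sub>L g x) differentiable (at x)"
  using assms bounded_bilinear.FDERIV[OF bounded_bilinear_blinfun_compose]
  unfolding differentiable_def by blast

text \<open>Smoothness speaks of directional derivatives; in finite dimension those along a basis
  determine the derivative as an operator.\<close>

lemma smooth_map_twice_differentiable:
  fixes f :: "'a::euclidean_space \<Rightarrow> 'b::real_normed_vector"
  assumes "smooth_map f"
  shows "twice_differentiable f"
proof -
  have "C_k (Suc (Suc 0)) f" using assms by (simp only: smooth_map_def)
  then have f: "f differentiable (at x)" and df: "(\<lambda>x. frechet_derivative f (at x) v) differentiable (at x)" for x v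
    by auto
  \<comment> \<open>Each summand is the rank-one operator sending \<open>v\<close> to
    \<open>(v \<bullet> b)\<close> times the derivative along \<open>b\<close>, so \<open>D\<close>
    inherits differentiability from its coefficients.\<close>
  define D where "D x = (\<Sum>b\<in>Basis. blinfun_scaleR_left (frechet_derivative f (at x) b) o\<^sub>L blinfun_inner_left b)" for x
  have "blinfun_apply (D x) v = frechet_derivative f (at x) v" for x v
  proof -
    have "linear (frechet_derivative f (at x))" by (rule linear_frechet_derivative[OF f])
    then have "frechet_derivative f (at x) (\<Sum>b\<in>Basis. (v \<bullet> b) *\<^sub>R b) = (\<Sum>b\<in>Basis. (v \<bullet> b) *\<^sub>R frechet_derivative f (at x) b)"
      by (simp add: linear_sum linear_scale)
    then show ?thesis by (simp add: D_def blinfun.sum_left euclidean_representation)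
  qed
  then have "blinfun_apply (D x) = frechet_derivative f (at x)" for x by auto
  moreover have "D differentiable (at x)" for x
    unfolding D_def
    by (intro differentiable_sum finite_Basis ballI differentiable_blinfun_compose differentiable_const
        differentiable_compose[OF bounded_linear_imp_differentiable[OF bounded_linear_blinfun_scaleR_left]] df)
  ultimately show ?thesis
    unfolding twice_differentiable_def using f by (metis frechet_derivative_works)
qed

lemma twice_differentiable_const: "twice_differentiable (\<lambda>_. c)"
  unfolding twice_differentiable_def by (intro exI[of _ "\<lambda>_. 0"]) (simp add: zero_blinfun.rep_eq)

lemma twice_differentiable_linear:
  fixes f :: "'a::euclidean_space \<Rightarrow> 'b::real_normed_vector"
  assumes "linear f" shows "twice_differentiable f"
  unfolding twice_differentiable_def
  using assms
  by (intro exI[of _ "\<lambda>_. Blinfun f"])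
    (simp add: bounded_linear_Blinfun_apply linear_conv_bounded_linear bounded_linear_imp_has_derivative)

lemma twice_differentiable_add:
  assumes "twice_differentiable f" "twice_differentiable g"
  shows "twice_differentiable (\<lambda>x. f x + g x)"
proof -
  obtain F G where
    "\<forall>x. (f has_derivative blinfun_apply (F x)) (at x) \<and> F differentiable (at x)"
    "\<forall>x. (g has_derivative blinfun_apply (G x)) (at x) \<and> G differentiable (at x)"
    using assms unfolding twice_differentiable_def by blast
  then show ?thesis
    unfolding twice_differentiable_def
    by (intro exI[of _ "\<lambda>x. F x + G x"]) (auto simp: plus_blinfun.rep_eq intro: has_derivative_add)
qed

lemma twice_differentiable_sum:
  assumes "\<And>i. i \<in> I \<Longrightarrow> twice_differentiable (f i)"
  shows "twice_differentiable (\<lambda>x. \<Sum>i\<in>I. f i x)"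
  using assms by (induction I rule: infinite_finite_induct)
    (auto intro: twice_differentiable_const twice_differentiable_add)

lemma twice_differentiable_compose:
  assumes "twice_differentiable f" "twice_differentiable g"
  shows "twice_differentiable (\<lambda>x. f (g x))"
proof -
  obtain F G where
    F: "\<And>x. (f has_derivative blinfun_apply (F x)) (at x)" "\<And>x. F differentiable (at x)" and
    G: "\<And>x. (g has_derivative blinfun_apply (G x)) (at x)" "\<And>x. G differentiable (at x)"
    using assms unfolding twice_differentiable_def by blast
  have "((\<lambda>x. f (g x)) has_derivative blinfun_apply (F (g x) o\<^sub>L G x)) (at x)" for x
    using has_derivative_compose[OF G(1) F(1)] by (simp add: blinfun_compose.rep_eq o_def)
  moreover have "(\<lambda>x. F (g x) o\<^sub>L G x) differentiable (at x)" for x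
    by (intro differentiable_blinfun_compose differentiable_compose[OF F(2)] G(2) differentiableI[OF G(1)])
  ultimately show ?thesis
    unfolding twice_differentiable_def by (intro exI[of _ "\<lambda>x. F (g x) o\<^sub>L G x"]) blast
qed

lemma twice_differentiable_Pair:
  fixes f :: "'a::real_normed_vector \<Rightarrow> 'b::euclidean_space" and g :: "'a \<Rightarrow> 'c::euclidean_space"
  assumes "twice_differentiable f" "twice_differentiable g"
  shows "twice_differentiable (\<lambda>x. (f x, g x))"
proof -
  have "twice_differentiable (\<lambda>x. (f x, 0) + (0, g x))"
    by (intro twice_differentiable_add
        twice_differentiable_compose[of "\<lambda>u::'b. (u, 0::'c)", OF twice_differentiable_linear]
        twice_differentiable_compose[of "\<lambda>u::'c. (0::'b, u)", OF twice_differentiable_linear] assms)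
      (auto intro!: linearI)
  then show ?thesis by simp
qed

text \<open>The derivative of a bilinear map depends linearly on the base point, so it is itself
  differentiable; composition with a pair gives the general case.\<close>

lemma twice_differentiable_bilinear:
  fixes h :: "'b::euclidean_space \<Rightarrow> 'c::euclidean_space \<Rightarrow> 'd::real_normed_vector"
  assumes h: "bilinear h" and "twice_differentiable f" "twice_differentiable g"
  shows "twice_differentiable (\<lambda>x. h (f x) (g x))"
proof -
  interpret bounded_bilinear h using h by (simp add: bilinear_conv_bounded_bilinear)
  define D where "D z = Blinfun (\<lambda>v. h (fst z) (snd v) + h (fst v) (snd z))" for z
  have bl: "bounded_linear (\<lambda>v. h (fst z) (snd v) + h (fst v) (snd z))" for z
    by (intro bounded_linear_add bounded_linear_compose[OF bounded_linear_right bounded_linear_snd]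
        bounded_linear_compose[OF bounded_linear_left bounded_linear_fst])
  have D: "blinfun_apply (D z) = (\<lambda>v. h (fst z) (snd v) + h (fst v) (snd z))" for z
    by (simp add: D_def bounded_linear_Blinfun_apply[OF bl])
  have "((\<lambda>z. h (fst z) (snd z)) has_derivative blinfun_apply (D z)) (at z)" for z
    unfolding D by (intro FDERIV has_derivative_fst has_derivative_snd has_derivative_ident)
  moreover have "linear D"
    by (intro linearI blinfun_eqI)
      (simp_all add: D blinfun.add_left blinfun.scaleR_left add_left add_right scaleR_left scaleR_right algebra_simps)
  then have "D differentiable (at z)" for z
    by (simp add: linear_conv_bounded_linear bounded_linear_imp_differentiable)
  ultimately have "twice_differentiable (\<lambda>z. h (fst z) (snd z))"
    unfolding twice_differentiable_def by blast
  from twice_differentiable_compose[OF this twice_differentiable_Pair[OF assms(2,3)]]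
  show ?thesis by simp
qed

lemma twice_differentiable_vec_lambda:
  fixes f :: "'n::finite \<Rightarrow> 'a::real_normed_vector \<Rightarrow> 'b::euclidean_space"
  assumes "\<And>k. twice_differentiable (f k)"
  shows "twice_differentiable (\<lambda>x. \<chi> k. f k x)"
  unfolding vec_lambda_eq_sum_axis
  by (intro twice_differentiable_sum
      twice_differentiable_compose[OF twice_differentiable_linear[OF bounded_linear.linear[OF bounded_linear_axis]]] assms)

subsection \<open>Forward kinematics\<close>

lemma rigid4_nth:
  "rigid4 A b $ 1 = hom4 (A $ 1) (b $ 1)" "rigid4 A b $ 2 = hom4 (A $ 2) (b $ 2)"
  "rigid4 A b $ 3 = hom4 (A $ 3) (b $ 3)" "rigid4 A b $ 4 = hom4 0 1"
  by (simp_all add: rigid4_def vector_def)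

lemma twice_differentiable_rigid4:
  assumes "twice_differentiable A" "twice_differentiable b"
  shows "twice_differentiable (\<lambda>x. rigid4 (A x) (b x))"
proof -
  \<comment> \<open>\<open>rigid4\<close> is affine rather than linear because of its constant last
    row, which is subtracted here.\<close>
  let ?L = "\<lambda>z. rigid4 (fst z) (snd z) - rigid4 0 0"
  have "linear ?L"
    by (intro linearI) (simp_all add: vec_eq_iff[where 'b = 4] forall_4 rigid4_nth)
  note twice_differentiable_compose[OF twice_differentiable_linear[OF this] twice_differentiable_Pair[OF assms]]
  from twice_differentiable_add[OF this twice_differentiable_const]
  have "twice_differentiable (\<lambda>x. ?L (A x, b x) + rigid4 0 0)" .
  then show ?thesis by simp
qed

lemma bilinear_matrix_mult: "bilinear ((**) :: real^'n^'m \<Rightarrow> real^'p^'n \<Rightarrow> real^'p^'m)"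
  unfolding bilinear_def
  by (auto intro!: linearI simp: vec_eq_iff matrix_matrix_mult_def sum.distrib sum_distrib_left algebra_simps)

lemma bilinear_matrix_vector_mult: "bilinear ((*v) :: real^'n^'m \<Rightarrow> real^'n \<Rightarrow> real^'m)"
  unfolding bilinear_def
  by (auto intro!: linearI simp: matrix_vector_mult_add_rdistrib matrix_vector_right_distrib
      scaleR_matrix_vector_assoc vector_scaleR_matrix_ac)

text \<open>Induction along the parent relation: every transformation is the product of the parent's
  with two rigid factors.\<close>

lemma (in robot) twice_differentiable_T:
  "twice_differentiable (\<lambda>z. T i (fst z) (snd z))"
proof (induction i rule: wf_induct_rule[OF wf_par])
  case (1 i)
  note of_fst = twice_differentiable_compose[OF smooth_map_twice_differentiable twice_differentiable_linear[OF linear_fst]]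
    and of_snd = twice_differentiable_compose[OF smooth_map_twice_differentiable twice_differentiable_linear[OF linear_snd]]
  have "twice_differentiable (\<lambda>z. case par i of None \<Rightarrow> mat 1 | Some a \<Rightarrow> T a (fst z) (snd z))"
    using 1 by (cases "par i") (auto intro: twice_differentiable_const)
  moreover have "twice_differentiable (\<lambda>z :: (real^'nd) \<times> (real^'nq). rigid4 (Rd i (fst z)) (td i (fst z)))"
    by (rule twice_differentiable_rigid4[OF of_fst[OF smooth_Rd] of_fst[OF smooth_td]])
  moreover have "twice_differentiable (\<lambda>z :: (real^'nd) \<times> (real^'nq). rigid4 (R i (snd z)) (t i (snd z)))"
    by (rule twice_differentiable_rigid4[OF of_snd[OF smooth_R] of_snd[OF smooth_t]])
  ultimately have "twice_differentiable (\<lambda>z. (case par i of None \<Rightarrow> mat 1 | Some a \<Rightarrow> T a (fst z) (snd z))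
      ** rigid4 (Rd i (fst z)) (td i (fst z)) ** rigid4 (R i (snd z)) (t i (snd z)))"
    by (intro twice_differentiable_bilinear[OF bilinear_matrix_mult])
  then show ?case by (subst kinematics)
qed

lemma (in robot) twice_differentiable_world_vertex:
  "twice_differentiable (\<lambda>z. world_vertex T vert i j (fst z) (snd z) m)"
proof -
  have first3: "linear first3"
    by (intro linearI) (simp_all add: vec_eq_iff forall_3 first3_def vector_3)
  have "linear (\<lambda>z :: (real^'nd) \<times> (real^'nq). hom4 (\<chi> k. fst z $ vert i j m k) 0)"
    by (intro linearI) (simp_all add: vec_eq_iff forall_4)
  then have "twice_differentiable (\<lambda>z :: (real^'nd) \<times> (real^'nq). hom4 (\<chi> k. fst z $ vert i j m k) 0 + hom4 0 1)"
    by (intro twice_differentiable_add twice_differentiable_const twice_differentiable_linear)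
  moreover have "hom4 v 0 + hom4 0 1 = hom4 v 1" for v
    by (simp add: vec_eq_iff forall_4)
  ultimately have "twice_differentiable (\<lambda>z :: (real^'nd) \<times> (real^'nq). local_vertex vert i j (fst z) m)"
    by (simp add: local_vertex_def)
  then show ?thesis
    unfolding world_vertex_def hom_world_vertex_def
    by (intro twice_differentiable_compose[OF twice_differentiable_linear[OF first3]]
        twice_differentiable_bilinear[OF bilinear_matrix_vector_mult] twice_differentiable_T)
qed

text \<open>Chain rule for operator-valued derivatives; finiteness is open, so the first derivative
  exists on a whole neighbourhood.\<close>

lemma ereal_twice_differentiable_potential:
  fixes g :: "'a::real_normed_vector \<Rightarrow> ('m::finite) vertices"
  assumes s: "0 < s" "s < 1" and g: "twice_differentiable g" and fin: "potential s (g x) < \<infinity>"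
  shows "ereal_twice_differentiable_at (\<lambda>x. potential s (g x)) x"
proof -
  obtain G where G: "\<And>x. (g has_derivative blinfun_apply (G x)) (at x)" "\<And>x. G differentiable (at x)"
    using g unfolding twice_differentiable_def by blast
  obtain p where p: "minimal s (g x) p" using minimal_exists[OF s(1) fin] .
  then have "feasible (g x) p" by (simp add: minimal_def)
  moreover have "(g \<longlongrightarrow> g x) (nhds x)"
    using has_derivative_continuous[OF G(1), of x]
    by (intro tendsto_at_iff_tendsto_nhds[of g, THEN iffD1]) (simp only: isCont_def)
  ultimately have ev: "\<forall>\<^sub>F u in nhds x. potential s (g u) < \<infinity>"
    by (rule eventually_compose_filterlim[OF eventually_potential_finite])
  let ?D = "\<lambda>u. blinfun_inner_left (potential_grad s (g u)) o\<^sub>L G u"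
  have "((\<lambda>v. real_potential s (g v)) has_derivative blinfun_apply (?D u)) (at u)"
    if finite_u: "potential s (g u) < \<infinity>" for u
  proof -
    obtain q where q: "minimal s (g u) q" using minimal_exists[OF s(1) finite_u] .
    have "(real_potential s has_derivative (\<lambda>h. h \<bullet> potential_grad s (g u))) (at (g u))"
      using gderiv_potential[OF s q] by (simp add: gderiv_def potential_grad_eq[OF s q])
    from has_derivative_compose[OF G(1) this] show ?thesis
      by (simp add: blinfun_compose.rep_eq o_def)
  qed
  then have "\<forall>\<^sub>F u in nhds x. ((\<lambda>v. real_potential s (g v)) has_derivative blinfun_apply (?D u)) (at u)"
    by (rule eventually_mono[OF ev])
  moreover have "?D differentiable (at x)"
    by (intro differentiable_blinfun_compose G(2)
        differentiable_compose[OF bounded_linear_imp_differentiable[OF bounded_linear_blinfun_inner_left]]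
        differentiable_compose[where f = "potential_grad s" and g = g, OF potential_grad_differentiable[OF s p]] differentiableI[OF G(1)])
  ultimately show ?thesis
    unfolding ereal_twice_differentiable_at_def potential_finite_iff
    by (intro conjI ev exI[of _ ?D])
qed

lemma potential_of_vertices:
  "world_contact_potential s y z = potential s (\<chi> k. case_sum y z k)"
  by (simp add: potential_def)

theorem mainTheorem1:
  fixes par :: "'l::finite \<Rightarrow> 'l option"
    and Rd :: "'l \<Rightarrow> real^'nd \<Rightarrow> real^3^3"
    and td :: "'l \<Rightarrow> real^'nd \<Rightarrow> real^3"
    and R :: "'l \<Rightarrow> real^'nq \<Rightarrow> real^3^3"
    and t :: "'l \<Rightarrow> real^'nq \<Rightarrow> real^3"
    and T :: "'l \<Rightarrow> real^'nd \<Rightarrow> real^'nq \<Rightarrow> real^4^4"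
    and vert :: "'l \<Rightarrow> 'j \<Rightarrow> 'm::finite \<Rightarrow> 3 \<Rightarrow> 'nd"
    and i i' :: 'l and j j' :: 'j and s :: real
  assumes "robot par Rd td R t T"
    and "i \<noteq> i'"
    and "0 < s" and "s < 1"
  shows
    "(\<forall>d \<theta>. setdist (world_polyhedron T vert i j d \<theta>) (world_polyhedron T vert i' j' d \<theta>) \<ge> 2 * s / (1 - s)
        \<longrightarrow> contact_potential s T vert i j i' j' d \<theta> = 0)
   \<and> ((\<lambda>(d, \<theta>). contact_potential s T vert i j i' j' d \<theta>) \<longlongrightarrow> \<infinity>)
       (filtercomap
          (\<lambda>(d, \<theta>). setdist (world_polyhedron T vert i j d \<theta>) (world_polyhedron T vert i' j' d \<theta>))
          (nhds 0))
   \<and> (\<forall>d \<theta>. contact_potential s T vert i j i' j' d \<theta> < \<infinity>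
        \<longrightarrow> ereal_twice_differentiable_at
              (\<lambda>(d, \<theta>). contact_potential s T vert i j i' j' d \<theta>) (d, \<theta>))
   \<and> (\<forall>d \<theta>. contact_potential s T vert i j i' j' d \<theta> < \<infinity> \<longrightarrow>
        (let y = world_vertex T vert i j d \<theta>; z = world_vertex T vert i' j' d \<theta> in
          \<exists>Gy Gz.
            (\<forall>m. ereal_has_gradient (\<lambda>v. world_contact_potential s (y(m := v)) z) (y m) (Gy m)) \<and>
            (\<forall>m. ereal_has_gradient (\<lambda>v. world_contact_potential s y (z(m := v))) (z m) (Gz m)) \<and>
            (\<Sum>m\<in>UNIV. Gy m) + (\<Sum>m\<in>UNIV. Gz m) = 0 \<and>
            (\<Sum>m\<in>UNIV. cross3 (y m) (Gy m)) + (\<Sum>m\<in>UNIV. cross3 (z m) (Gz m)) = 0))"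
proof -
  interpret robot par Rd td R t T by fact
  note s = \<open>0 < s\<close> \<open>s < 1\<close>
  define W where "W d \<theta> = (\<chi> k. case_sum (world_vertex T vert i j d \<theta>) (world_vertex T vert i' j' d \<theta>) k)" for d \<theta>
  have pot: "contact_potential s T vert i j i' j' d \<theta> = potential s (W d \<theta>)" for d \<theta>
    unfolding contact_potential_world potential_of_vertices W_def ..
  have poly: "world_polyhedron T vert i j d \<theta> = convex hull range (\<lambda>m. W d \<theta> $ Inl m)"
    "world_polyhedron T vert i' j' d \<theta> = convex hull range (\<lambda>m. W d \<theta> $ Inr m)" for d \<theta>
    by (simp_all add: world_polyhedron_def W_def)
  have C2: "twice_differentiable (\<lambda>z. W (fst z) (snd z))"
    unfolding W_def
    by (intro twice_differentiable_vec_lambda, case_tac k)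
      (simp_all add: twice_differentiable_world_vertex)
  show ?thesis
  proof (intro conjI allI impI)
    fix d \<theta>
    assume "setdist (world_polyhedron T vert i j d \<theta>) (world_polyhedron T vert i' j' d \<theta>) \<ge> 2 * s / (1 - s)"
    then show "contact_potential s T vert i j i' j' d \<theta> = 0"
      unfolding pot poly by (rule potential_zero_of_setdist[OF s])
  next
    let ?dist = "\<lambda>(d, \<theta>). setdist (world_polyhedron T vert i j d \<theta>) (world_polyhedron T vert i' j' d \<theta>)"
    have "\<forall>\<^sub>F x in filtercomap ?dist (nhds 0). ereal B < (case x of (d, \<theta>) \<Rightarrow> contact_potential s T vert i j i' j' d \<theta>)" for B
    proof -
      \<comment> \<open>Every configuration with distance below \<open>r\<close> then has potential
        above \<open>B\<close>, including those in contact, which the filter contains.\<close>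
      obtain r where r: "0 < r" "B < pen s r" using pen_large[OF s(1)] .
      have "\<forall>\<^sub>F x in filtercomap ?dist (nhds 0). ?dist x < r"
        using r by (intro eventually_filtercomapI order_tendstoD(2)[OF filterlim_ident]) auto
      then show ?thesis
      proof eventually_elim
        case (elim x)
        then have "ereal (pen s r) \<le> potential s (W (fst x) (snd x))"
          by (intro potential_lower_bound) (simp add: case_prod_beta poly)
        then show ?case using r(2) less_le_trans[of "ereal B" "ereal (pen s r)"] by (simp add: case_prod_beta pot)
      qed
    qed
    then show "((\<lambda>(d, \<theta>). contact_potential s T vert i j i' j' d \<theta>) \<longlongrightarrow> \<infinity>) (filtercomap ?dist (nhds 0))"
      by (simp add: tendsto_PInfty)
  next
    fix d \<theta> assume "contact_potential s T vert i j i' j' d \<theta> < \<infinity>"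
    then show "ereal_twice_differentiable_at (\<lambda>(d, \<theta>). contact_potential s T vert i j i' j' d \<theta>) (d, \<theta>)"
      using ereal_twice_differentiable_potential[OF s C2, of "(d, \<theta>)"] by (simp add: pot case_prod_beta')
  next
    fix d \<theta> assume "contact_potential s T vert i j i' j' d \<theta> < \<infinity>"
    then obtain p where p: "minimal s (W d \<theta>) p"
      using minimal_exists[OF s(1)] by (metis pot)
    let ?y = "world_vertex T vert i j d \<theta>" and ?z = "world_vertex T vert i' j' d \<theta>"
    let ?G = "vertex_grad s (W d \<theta>) p"
    have y: "W d \<theta> $ Inl m = ?y m" and z: "W d \<theta> $ Inr m = ?z m" for m by (simp_all add: W_def)
    \<comment> \<open>Replacing one vertex is rewritten as a shift along one axis of the joint
      vector, the form in which partial gradients were computed.\<close>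
    have upd_y: "world_contact_potential s (?y(m := v)) ?z = potential s (W d \<theta> + axis (Inl m) (v - W d \<theta> $ Inl m))" for m v
      unfolding potential_of_vertices
      by (rule arg_cong[of _ _ "potential s"]) (auto simp: vec_eq_iff W_def axis_def split: sum.splits)
    have upd_z: "world_contact_potential s ?y (?z(m := v)) = potential s (W d \<theta> + axis (Inr m) (v - W d \<theta> $ Inr m))" for m v
      unfolding potential_of_vertices
      by (rule arg_cong[of _ _ "potential s"]) (auto simp: vec_eq_iff W_def axis_def split: sum.splits)
    have "(\<forall>m. ereal_has_gradient (\<lambda>v. world_contact_potential s (?y(m := v)) ?z) (?y m) (?G $ Inl m)) \<and>
      (\<forall>m. ereal_has_gradient (\<lambda>v. world_contact_potential s ?y (?z(m := v))) (?z m) (?G $ Inr m)) \<and>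
      (\<Sum>m\<in>UNIV. ?G $ Inl m) + (\<Sum>m\<in>UNIV. ?G $ Inr m) = 0 \<and>
      (\<Sum>m\<in>UNIV. cross3 (?y m) (?G $ Inl m)) + (\<Sum>m\<in>UNIV. cross3 (?z m) (?G $ Inr m)) = 0"
      unfolding upd_y upd_z
      using potential_gradient_component[OF s p, of "Inl _"] potential_gradient_component[OF s p, of "Inr _"]
        momentum_balance[OF s p] unfolding sum_UNIV_Plus by (simp add: y z)
    then show "let y = ?y; z = ?z in \<exists>Gy Gz.
            (\<forall>m. ereal_has_gradient (\<lambda>v. world_contact_potential s (y(m := v)) z) (y m) (Gy m)) \<and>
            (\<forall>m. ereal_has_gradient (\<lambda>v. world_contact_potential s y (z(m := v))) (z m) (Gz m)) \<and>
            (\<Sum>m\<in>UNIV. Gy m) + (\<Sum>m\<in>UNIV. Gz m) = 0 \<and>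
            (\<Sum>m\<in>UNIV. cross3 (y m) (Gy m)) + (\<Sum>m\<in>UNIV. cross3 (z m) (Gz m)) = 0"
      unfolding Let_def by (intro exI[of _ "\<lambda>m. ?G $ Inl m"] exI[of _ "\<lambda>m. ?G $ Inr m"])
  qed
qed

end
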